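(* Let $N,p,q,\sigma$ be real numbers with $q>p-1>0$ and $p>N>-\sigma$. Consider the positive solutions of $$-(|w'|^{p-2}w')'-\frac{N-1}{r}|w'|^{p-2}w'=\varepsilon r^{\sigma}w^{q},\qquad \varepsilon=\pm1 .$$ • For $\varepsilon=\pm1$ there exist local solutions near $0$, continuous up to $r=0$, of three types: $$\lim_{r\to0}w=w_0>0,\qquad \lim_{r\to0}r^{-\frac{\sigma+1}{p-1}}w'=-\varepsilon c(w_0),\quad c(w_0)>0;$$ $$\lim_{r\to0}w=0,\qquad \lim_{r\to0}r^{\frac{N-p}{p-1}}w=k>0,\qquad \lim_{r\to0}r^{\frac{N-1}{p-1}}w'=c(k)>0;$$ $$\lim_{r\to0}w=w_0>0,\qquad \lim_{r\to0}r^{\frac{N-1}{p-1}}w'=-\varepsilon c(w_0),\quad c(w_0)>0.$$ For $\varepsilon=1$ they are not global, and there is no solution in $(r_0,\infty)$, $r_0>0$. For $\varepsilon=-1$ there exist two types of global solutions in $(0,\infty)$: • $w^*(r)=a^*r^{-\frac{p+\sigma}{q+1-p}}$; • solutions such that $\lim_{r\to0}w=w_0>0$, $\lim_{r\to0}r^{\frac{N-1}{p-1}}w'=-c(w_0)<0$, and $w\sim w^*$ as $r\to\infty$.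
   Context: $N$ is not necessarily an integer. With $\gamma=\frac{p+\sigma}{q+1-p}$, $a^*>0$ is defined by $(a^* )^{q-p+1}=\varepsilon|\gamma|^{p-2}\gamma\,(N-p-(p-1)\gamma)$ with $\varepsilon=-1$. A local solution near $0$ is a positive solution on $(0,r_0)$ for some $r_0>0$; a solution is global if it is a positive solution on $(0,\infty)$. $c(\cdot)$ denotes a positive constant associated with the solution. $f\sim g$ means $f/g\to1$. *)

theory Defs
  imports "HOL-Analysis.Analysis" "HOL-Library.Landau_Symbols"
begin

unbundle asymp_equiv_syntax

definition flux :: "real \<Rightarrow> real \<Rightarrow> real" where
  "flux p s = \<bar>s\<bar> powr (p - 2) * s"  (* also 0 at s = 0 when p < 2, since 0 powr a = 0 *)

(* Only used for open intervals I contained in (0,\<infinity>).  No C^1 requirement is needed: the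
   flux is differentiable, hence continuous, so w' is continuous, and the equation then makes the
   derivative of the flux continuous. *)
definition positive_solution ::
  "real \<Rightarrow> real \<Rightarrow> real \<Rightarrow> real \<Rightarrow> real \<Rightarrow> real set \<Rightarrow> (real \<Rightarrow> real) \<Rightarrow> bool" where
  "positive_solution N p q \<sigma> \<epsilon> I w \<longleftrightarrow>
     (\<forall>r\<in>I. w r > 0 \<and>
        w differentiable (at r) \<and>
        (\<lambda>s. flux p (deriv w s)) differentiable (at r) \<and>
        - deriv (\<lambda>s. flux p (deriv w s)) r - (N - 1) / r * flux p (deriv w r)
          = \<epsilon> * r powr \<sigma> * w r powr q)"

definition local_solution ::
  "real \<Rightarrow> real \<Rightarrow> real \<Rightarrow> real \<Rightarrow> real \<Rightarrow> (real \<Rightarrow> real) \<Rightarrow> bool" where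
  "local_solution N p q \<sigma> \<epsilon> w \<longleftrightarrow> (\<exists>r0>0. positive_solution N p q \<sigma> \<epsilon> {0<..<r0} w)"

definition global_solution ::
  "real \<Rightarrow> real \<Rightarrow> real \<Rightarrow> real \<Rightarrow> real \<Rightarrow> (real \<Rightarrow> real) \<Rightarrow> bool" where
  "global_solution N p q \<sigma> \<epsilon> w \<longleftrightarrow> positive_solution N p q \<sigma> \<epsilon> {0<..} w"

definition gam :: "real \<Rightarrow> real \<Rightarrow> real \<Rightarrow> real" where
  "gam p q \<sigma> = (p + \<sigma>) / (q + 1 - p)"

(* The case \<epsilon> = -1 of a^(q-p+1) = \<epsilon> |\<gamma>|^(p-2) \<gamma> (N - p - (p-1) \<gamma>). *)
definition astar :: "real \<Rightarrow> real \<Rightarrow> real \<Rightarrow> real \<Rightarrow> real" where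
  "astar N p q \<sigma> = (THE a. a > 0 \<and>
     a powr (q - p + 1) =
       (-1) * (\<bar>gam p q \<sigma>\<bar> powr (p - 2) * gam p q \<sigma> * (N - p - (p - 1) * gam p q \<sigma>)))"

definition wstar :: "real \<Rightarrow> real \<Rightarrow> real \<Rightarrow> real \<Rightarrow> real \<Rightarrow> real" where
  "wstar N p q \<sigma> r = astar N p q \<sigma> * r powr (- ((p + \<sigma>) / (q + 1 - p)))"

end

theory Submission
  imports Defs "HOL-Complex_Analysis.Great_Picard"
begin

text \<open>Put \<open>u = r\<^bsup>N-1\<^esup> |w'|\<^bsup>p-2\<^esup> w'\<close>. The equation becomes the system
\<open>w' = r\<^bsup>-(N-1)/(p-1)\<^esup> \<psi>(u)\<close>, \<open>u' = - \<epsilon> r\<^bsup>N+\<sigma>-1\<^esup> w\<^bsup>q\<^esup>\<close>, where \<open>\<psi>\<close> is the odd extension of the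
power \<open>1/(p-1)\<close>. Because \<open>p > N\<close> and \<open>N + \<sigma> > 0\<close>, both weights are integrable at \<open>0\<close>, so the origin is
a regular point: the initial values \<open>w(0)\<close> and \<open>u(0)\<close> can be prescribed freely. The substitution
\<open>r = x\<^bsup>m\<^esup>\<close> with \<open>m\<close> large even makes the weights continuous.

Neither \<open>\<psi>\<close> nor the power \<open>q\<close> need be Lipschitz at \<open>0\<close>, so solutions come from compactness
(Tonelli's approximations, where the equation for \<open>u\<close> sees the profile with a small delay) and not from a
contraction. The initial data \<open>(w\<^sub>0, 0)\<close>, \<open>(0, u\<^sub>0)\<close> with \<open>u\<^sub>0 > 0\<close>, and \<open>(w\<^sub>0, - \<epsilon>)\<close> give
the three local types; the rates at \<open>0\<close> follow from l'Hopital's rule (lemma \<open>cauchy_problem_at_0\<close> and its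
three consequences).

For \<open>\<epsilon> = 1\<close> the flux \<open>u\<close> decreases. If it becomes negative, then \<open>w\<close> falls at least like a negative
multiple of \<open>r\<^bsup>(p-N)/(p-1)\<^esup>\<close> and loses its sign; if it stays nonnegative, then \<open>w\<close> is nondecreasing and the
equation forces \<open>u\<close> to \<open>- \<infinity>\<close>. So no positive solution reaches infinity
(\<open>no_positive_solution_near_infinity\<close>).

For \<open>\<epsilon> = -1\<close> a solution decaying from \<open>w\<^sub>0\<close> is found by shooting. The delayed problem depends continuously
on the initial flux, without any uniqueness question, so the intermediate value theorem lets the \<open>n\<close>-th
approximation have zero flux at the point \<open>n + 1\<close>. In the limit the flux is nonpositive on the whole half-line;
that the limit does not touch zero is a Gronwall argument using \<open>q > p - 1\<close> (\<open>no_dead_core\<close>).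

The asymptotics of this solution use a comparison principle and the scaling invariance
\<open>w(r) \<mapsto> \<mu>\<^bsup>\<gamma>\<^esup> w(\<mu> r)\<close>. Comparison with \<open>w*\<close>, which is infinite at \<open>0\<close>, gives \<open>w \<le> w*\<close>;
comparison of \<open>w\<close> with its own rescalings shows that \<open>r\<^bsup>\<gamma>\<^esup> w\<close> is nondecreasing. Hence it has a finite positive
limit \<open>L\<close>, and integrating the system twice from infinity leaves \<open>L = a*\<close> as the only possibility
(\<open>decreasing_solution_asymptotic\<close>).\<close>

section \<open>Compactness of locally Lipschitz families\<close>

text \<open>A diagonal argument over the rational points, in the spirit of Arzela and Ascoli. Pointwise convergence on the
whole line is enough here, since the limit passes through the integral equations by dominated convergence.\<close>

lemma pointwise_convergent_subsequence_of_locally_lipschitz: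
  fixes f :: "nat \<Rightarrow> real \<Rightarrow> real"
  assumes lip: "\<And>X. \<exists>L. \<forall>n. \<forall>x\<le>X. \<forall>y\<le>X. \<bar>f n x - f n y\<bar> \<le> L * \<bar>x - y\<bar>"
    and anchor: "\<And>n. f n 0 = y0"
  obtains k g where "strict_mono (k :: nat \<Rightarrow> nat)" "\<And>x. (\<lambda>n. f (k n) x) \<longlonglongrightarrow> g x"
proof -
  have "\<exists>B>0. \<forall>n. \<bar>f n x\<bar> \<le> B" for x
  proof -
    obtain L where L: "\<And>n u v. u \<le> max x 0 \<Longrightarrow> v \<le> max x 0 \<Longrightarrow> \<bar>f n u - f n v\<bar> \<le> L * \<bar>u - v\<bar>"
      using lip[of "max x 0"] by blast
    have "\<bar>f n x\<bar> \<le> \<bar>y0\<bar> + \<bar>L * \<bar>x\<bar>\<bar> + 1" for n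
      using L[of x 0 n] anchor[of n] by auto
    then show ?thesis by (intro exI[of _ "\<bar>y0\<bar> + \<bar>L * \<bar>x\<bar>\<bar> + 1"]) auto
  qed
  then obtain B where B: "\<And>x. B x > 0" "\<And>x n. \<bar>f n x\<bar> \<le> B x" by metis
  have cQ: "countable (\<rat> :: real set)" by (rule countable_rat)
  \<comment> \<open>Dividing by the pointwise bound produces a uniformly bounded family.\<close>
  have bd: "norm (f n x / B x) \<le> 1" for n x
    using B(1)[of x] B(2)[where x = x and n = n] by (simp add: divide_le_eq)
  obtain k where k: "strict_mono (k :: nat \<Rightarrow> nat)"
    "\<And>x. x \<in> \<rat> \<Longrightarrow> \<exists>l. (\<lambda>n. f (k n) x / B x) \<longlonglongrightarrow> l"
    using function_convergent_subsequence[OF cQ, where f = "\<lambda>n x. f n x / B x" and M = 1] bd by blast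
  have conv_rat: "convergent (\<lambda>n. f (k n) x)" if "x \<in> \<rat>" for x
  proof -
    obtain l where "(\<lambda>n. f (k n) x / B x) \<longlonglongrightarrow> l" using k(2) \<open>x \<in> \<rat>\<close> by blast
    then have "(\<lambda>n. f (k n) x / B x * B x) \<longlonglongrightarrow> l * B x" by (intro tendsto_intros)
    moreover have "B x \<noteq> 0" using B(1)[of x] by simp
    ultimately show ?thesis by (auto simp: convergent_def)
  qed
  have "convergent (\<lambda>n. f (k n) x)" for x
  proof -
    obtain L0 where L0: "\<And>n u v. u \<le> x+1 \<Longrightarrow> v \<le> x+1 \<Longrightarrow> \<bar>f n u - f n v\<bar> \<le> L0 * \<bar>u - v\<bar>"
      using lip[of "x+1"] by blast
    define L where "L = \<bar>L0\<bar> + 1"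
    have L: "\<bar>f n u - f n v\<bar> \<le> L * \<bar>u - v\<bar>" if "u \<le> x+1" "v \<le> x+1" for n u v
    proof -
      have "L0 * \<bar>u - v\<bar> \<le> L * \<bar>u - v\<bar>" unfolding L_def by (intro mult_right_mono) auto
      then show ?thesis using L0[OF that, of n] by linarith
    qed
    have Lpos: "L > 0" unfolding L_def by auto
    have "Cauchy (\<lambda>n. f (k n) x)"
    proof (rule metric_CauchyI)
      fix e :: real assume e: "e > 0"
      define d where "d = min 1 (e / (3 * L))"
      have d: "d > 0" "d \<le> 1" "L * d \<le> e/3" using e Lpos by (auto simp: d_def min_def field_simps)
      obtain y where y: "y \<in> \<rat>" "x < y" "y < x + d" using Rats_dense_in_real[of x "x+d"] d by auto
      have "Cauchy (\<lambda>n. f (k n) y)" using conv_rat[OF y(1)] by (rule convergent_Cauchy)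
      then obtain M where M: "\<And>m n. m \<ge> M \<Longrightarrow> n \<ge> M \<Longrightarrow> dist (f (k m) y) (f (k n) y) < e/3"
        using metric_CauchyD[of _ "e/3"] e by (metis divide_pos_pos zero_less_numeral)
      have near: "\<bar>f n x - f n y\<bar> \<le> e/3" for n
      proof -
        have "\<bar>f n x - f n y\<bar> \<le> L * \<bar>x - y\<bar>" using L[of x y n] y d by auto
        also have "\<dots> \<le> L * d" using y Lpos by (intro mult_left_mono) auto
        finally show ?thesis using d(3) by linarith
      qed
      show "\<exists>M. \<forall>m\<ge>M. \<forall>n\<ge>M. dist (f (k m) x) (f (k n) x) < e"
      proof (intro exI allI impI)
        fix m n assume "m \<ge> M" "n \<ge> M"
        then show "dist (f (k m) x) (f (k n) x) < e"
          using M[of m n] near[of "k m"] near[of "k n"] unfolding dist_real_def by linarith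
      qed
    qed
    then show ?thesis by (simp add: Cauchy_convergent_iff)
  qed
  then obtain g where "\<And>x. (\<lambda>n. f (k n) x) \<longlonglongrightarrow> g x" unfolding convergent_def by metis
  with k(1) show ?thesis by (rule that)
qed

text \<open>For negative upper limits the integral over the empty interval vanishes. This convention extends every profile
below to the left of \<open>0\<close> by its initial value, which is what a delayed argument needs.\<close>

lemma integral_from_0_max: "integral {0..x} f = integral {0..max x 0} (f :: real \<Rightarrow> real)"
proof (cases "x \<ge> 0")
  case False
  then have "{0..x} = {}" "max x 0 = 0" by auto
  then show ?thesis by simp
qed (simp add: max_def)

lemma integral_from_0_lipschitz:
  fixes f :: "real \<Rightarrow> real"
  assumes "continuous_on UNIV f" and bd: "\<And>s. s \<in> {0..X} \<Longrightarrow> \<bar>f s\<bar> \<le> L" and "0 \<le> L"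
    and "x \<le> X" "y \<le> X"
  shows "\<bar>integral {0..x} f - integral {0..y} f\<bar> \<le> L * \<bar>x - y\<bar>"
proof -
  have int: "f integrable_on {u..v}" for u v
    by (rule integrable_continuous_real) (meson assms(1) continuous_on_subset subset_UNIV)
  have main: "\<bar>integral {0..v} f - integral {0..u} f\<bar> \<le> L * (v - u)" if "0 \<le> u" "u \<le> v" "v \<le> X" for u v
  proof -
    have "integral {0..u} f + integral {u..v} f = integral {0..v} f"
      using that int by (intro Henstock_Kurzweil_Integration.integral_combine) auto
    moreover have "norm (integral {u..v} f) \<le> L * (v - u)"
    proof (rule integral_bound)
      show "continuous_on {u..v} f" by (meson assms(1) continuous_on_subset subset_UNIV)
    qed (use that bd in auto)
    ultimately show ?thesis by auto
  qed
  define x' y' where "x' = max x 0" and "y' = max y 0"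
  show ?thesis
  proof (cases "X \<ge> 0")
    case True
    have range: "0 \<le> x'" "0 \<le> y'" "x' \<le> X" "y' \<le> X" using assms(4,5) True by (auto simp: x'_def y'_def)
    have *: "\<bar>integral {0..x'} f - integral {0..y'} f\<bar> \<le> L * \<bar>x' - y'\<bar>"
    proof (cases "x' \<le> y'")
      case True
      then show ?thesis using main[of x' y'] range by (simp add: abs_minus_commute)
    next
      case False
      then show ?thesis using main[of y' x'] range by simp
    qed
    have "L * \<bar>x' - y'\<bar> \<le> L * \<bar>x - y\<bar>"
      using \<open>0 \<le> L\<close> by (intro mult_left_mono) (auto simp: x'_def y'_def)
    with * show ?thesis unfolding x'_def y'_def by (simp add: integral_from_0_max[symmetric])
  next
    case False
    then have "{0..x} = {}" "{0..y} = {}" using assms(4,5) by auto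
    then show ?thesis using \<open>0 \<le> L\<close> by simp
  qed
qed

lemma continuous_bounded_on_interval:
  fixes f :: "real \<Rightarrow> real"
  assumes "continuous_on UNIV f"
  obtains L where "L \<ge> 0" "\<And>s. s \<in> {u..v} \<Longrightarrow> \<bar>f s\<bar> \<le> L"
proof -
  have "compact (f ` {u..v})"
    by (intro compact_continuous_image) (use assms continuous_on_subset in auto)
  then have "bounded (f ` {u..v})" by (rule compact_imp_bounded)
  then obtain K where "\<And>y. y \<in> f ` {u..v} \<Longrightarrow> norm y \<le> K" unfolding bounded_iff by blast
  then have "\<And>s. s \<in> {u..v} \<Longrightarrow> \<bar>f s\<bar> \<le> \<bar>K\<bar>" by fastforce
  then show ?thesis by (intro that[of "\<bar>K\<bar>"]) auto
qed

lemma locally_lipschitz_continuous: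
  fixes f :: "real \<Rightarrow> real"
  assumes "\<And>X. \<exists>L. \<forall>x\<le>X. \<forall>y\<le>X. \<bar>f x - f y\<bar> \<le> L * \<bar>x - y\<bar>"
  shows "continuous_on UNIV f"
proof -
  have "isCont f x" for x
  proof -
    obtain L where L: "\<And>u v. u \<le> x+1 \<Longrightarrow> v \<le> x+1 \<Longrightarrow> \<bar>f u - f v\<bar> \<le> L * \<bar>u - v\<bar>"
      using assms[of "x+1"] by blast
    have "(\<lambda>u. f u - f x) \<midarrow>x\<rightarrow> 0"
    proof (rule Lim_null_comparison)
      show "\<forall>\<^sub>F u in at x. norm (f u - f x) \<le> L * \<bar>u - x\<bar>"
        unfolding eventually_at by (intro exI[of _ 1]) (auto simp: dist_real_def intro!: L)
      have "(\<lambda>u. L * \<bar>u - x\<bar>) \<midarrow>x\<rightarrow> L * \<bar>x - x\<bar>" by (intro tendsto_intros)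
      then show "(\<lambda>u. L * \<bar>u - x\<bar>) \<midarrow>x\<rightarrow> 0" by simp
    qed
    then show ?thesis unfolding isCont_def by (simp add: LIM_zero_iff)
  qed
  then show ?thesis by (simp add: continuous_at_imp_continuous_on)
qed

lemma integral_from_0_continuous:
  fixes f :: "real \<Rightarrow> real"
  assumes "continuous_on UNIV f"
  shows "continuous_on UNIV (\<lambda>x. integral {0..x} f)"
proof (rule locally_lipschitz_continuous)
  fix X
  obtain L where "L \<ge> 0" "\<And>s. s \<in> {0..X} \<Longrightarrow> \<bar>f s\<bar> \<le> L"
    using continuous_bounded_on_interval[OF assms] by metis
  then show "\<exists>L. \<forall>x\<le>X. \<forall>y\<le>X. \<bar>integral {0..x} f - integral {0..y} f\<bar> \<le> L * \<bar>x - y\<bar>"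
    using integral_from_0_lipschitz[OF assms, of X L] by blast
qed

lemma integral_from_0_deriv:
  fixes f :: "real \<Rightarrow> real"
  assumes "continuous_on UNIV f" "x > 0"
  shows "((\<lambda>x. integral {0..x} f) has_real_derivative f x) (at x)"
proof -
  have "continuous_on {0..x+1} f" by (meson assms(1) continuous_on_subset subset_UNIV)
  then have "((\<lambda>x. integral {0..x} f) has_real_derivative f x) (at x within {0..x+1})"
    using assms(2) by (intro integral_has_real_derivative) auto
  moreover have "at x within {0..x+1} = at x"
    using assms(2) by (intro at_within_interior) auto
  ultimately show ?thesis by simp
qed

section \<open>Existence by delayed approximations\<close>

text \<open>The system \<open>w' = a psi(v)\<close>, \<open>v' = b F(w)\<close> with continuous coefficients and bounded \<open>F\<close>. Solutions are built by
Tonelli's method: in the equation for \<open>v\<close> the profile is evaluated at \<open>s - h\<close>, so that the solution on one interval of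
length \<open>h\<close> determines the next.\<close>

locale weighted_system =
  fixes a b F psi :: "real \<Rightarrow> real" and M :: real
  assumes cont_a: "continuous_on UNIV a" and cont_b: "continuous_on UNIV b"
    and cont_F: "continuous_on UNIV F" and cont_psi: "continuous_on UNIV psi"
    and F_bound: "\<And>y. \<bar>F y\<bar> \<le> M"
begin

definition flux_of :: "real \<Rightarrow> (real \<Rightarrow> real) \<Rightarrow> real \<Rightarrow> real" where
  "flux_of c w x = c + integral {0..x} (\<lambda>s. b s * F (w s))"

definition profile_of :: "real \<Rightarrow> (real \<Rightarrow> real) \<Rightarrow> real \<Rightarrow> real" where
  "profile_of w0 v x = w0 + integral {0..x} (\<lambda>s. a s * psi (v s))"

definition delayed :: "real \<Rightarrow> real \<Rightarrow> real \<Rightarrow> (real \<Rightarrow> real) \<Rightarrow> real \<Rightarrow> real" where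
  "delayed h c w0 w = profile_of w0 (flux_of c (\<lambda>s. w (s - h)))"

definition tonelli :: "real \<Rightarrow> real \<Rightarrow> real \<Rightarrow> nat \<Rightarrow> real \<Rightarrow> real" where
  "tonelli h c w0 k = (delayed h c w0 ^^ k) (\<lambda>_. w0)"

lemma M_nonneg: "M \<ge> 0" using F_bound[of 0] by linarith

lemma cont_bF: "continuous_on UNIV w \<Longrightarrow> continuous_on UNIV (\<lambda>s. b s * F (w s))"
  by (intro continuous_intros cont_b continuous_on_compose2[OF cont_F]) auto

lemma cont_apsi: "continuous_on UNIV v \<Longrightarrow> continuous_on UNIV (\<lambda>s. a s * psi (v s))"
  by (intro continuous_intros cont_a continuous_on_compose2[OF cont_psi]) auto

lemma cont_flux_of: "continuous_on UNIV w \<Longrightarrow> continuous_on UNIV (flux_of c w)"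
  unfolding flux_of_def by (intro continuous_intros integral_from_0_continuous cont_bF)

lemma cont_profile_of: "continuous_on UNIV v \<Longrightarrow> continuous_on UNIV (profile_of w0 v)"
  unfolding profile_of_def by (intro continuous_intros integral_from_0_continuous cont_apsi)

lemma cont_shift: "continuous_on UNIV w \<Longrightarrow> continuous_on UNIV (\<lambda>s. w (s - h) :: real)" for h :: real
  by (rule continuous_on_compose2[of UNIV w]) (auto intro!: continuous_intros)

lemma cont_delayed: "continuous_on UNIV w \<Longrightarrow> continuous_on UNIV (delayed h c w0 w)"
  unfolding delayed_def by (intro cont_profile_of cont_flux_of cont_shift)

lemma cont_tonelli: "continuous_on UNIV (tonelli h c w0 k)"
  by (induction k) (auto simp: tonelli_def intro!: cont_delayed)

lemma flux_of_nonpos [simp]: "x \<le> 0 \<Longrightarrow> flux_of c w x = c"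
  by (cases "x = 0") (auto simp: flux_of_def)

lemma profile_of_nonpos [simp]: "x \<le> 0 \<Longrightarrow> profile_of w0 v x = w0"
  by (cases "x = 0") (auto simp: profile_of_def)

lemma deriv_flux_of:
  "continuous_on UNIV w \<Longrightarrow> x > 0 \<Longrightarrow> (flux_of c w has_real_derivative b x * F (w x)) (at x)"
  unfolding flux_of_def
  by (auto intro!: derivative_eq_intros integral_from_0_deriv[OF cont_bF])

lemma deriv_profile_of:
  "continuous_on UNIV v \<Longrightarrow> x > 0 \<Longrightarrow> (profile_of w0 v has_real_derivative a x * psi (v x)) (at x)"
  unfolding profile_of_def
  by (auto intro!: derivative_eq_intros integral_from_0_deriv[OF cont_apsi])

text \<open>Since \<open>F\<close> is bounded, the flux is bounded on compact intervals independently of the profile that produces it.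
All later equicontinuity rests on this.\<close>

lemma flux_of_local_bound:
  obtains R where "R \<ge> 0"
    "\<And>c w x. \<bar>c\<bar> \<le> C \<Longrightarrow> continuous_on UNIV w \<Longrightarrow> x \<le> X \<Longrightarrow> \<bar>flux_of c w x\<bar> \<le> R"
proof -
  obtain L where L: "L \<ge> 0" "\<And>s. s \<in> {0..X} \<Longrightarrow> \<bar>b s\<bar> \<le> L"
    using continuous_bounded_on_interval[OF cont_b] by metis
  have "\<bar>flux_of c w x\<bar> \<le> \<bar>C\<bar> + L * M * \<bar>X\<bar>" if "\<bar>c\<bar> \<le> C" "continuous_on UNIV w" "x \<le> X" for c w x
  proof (cases "x \<ge> 0")
    case True
    have "\<bar>integral {0..x} (\<lambda>s. b s * F (w s)) - integral {0..0} (\<lambda>s. b s * F (w s))\<bar> \<le> L * M * \<bar>x - 0\<bar>"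
      using True that L M_nonneg
      by (intro integral_from_0_lipschitz[of _ X] cont_bF)
         (auto simp: abs_mult intro!: mult_mono F_bound)
    moreover have "L * M * \<bar>x - 0\<bar> \<le> L * M * \<bar>X\<bar>" using True that L M_nonneg by (intro mult_left_mono) auto
    ultimately show ?thesis using that unfolding flux_of_def by auto
  next
    case False
    have "0 \<le> L * M * \<bar>X\<bar>" using L M_nonneg by auto
    with False show ?thesis using that by auto
  qed
  moreover have "\<bar>C\<bar> + L * M * \<bar>X\<bar> \<ge> 0" using L M_nonneg by auto
  ultimately show ?thesis using that by blast
qed

lemma delayed_lipschitz:
  "\<exists>L. \<forall>h c w. \<bar>c\<bar> \<le> C \<longrightarrow> continuous_on UNIV w \<longrightarrow>
     (\<forall>x\<le>X. \<forall>y\<le>X. \<bar>delayed h c w0 w x - delayed h c w0 w y\<bar> \<le> L * \<bar>x - y\<bar>)"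
proof -
  obtain R where R: "R \<ge> 0" "\<And>c w x. \<bar>c\<bar> \<le> C \<Longrightarrow> continuous_on UNIV w \<Longrightarrow> x \<le> X \<Longrightarrow> \<bar>flux_of c w x\<bar> \<le> R"
    using flux_of_local_bound by metis
  obtain P where P: "P \<ge> 0" "\<And>s. s \<in> {-R..R} \<Longrightarrow> \<bar>psi s\<bar> \<le> P"
    using continuous_bounded_on_interval[OF cont_psi] by metis
  obtain A where A: "A \<ge> 0" "\<And>s. s \<in> {0..X} \<Longrightarrow> \<bar>a s\<bar> \<le> A"
    using continuous_bounded_on_interval[OF cont_a] by metis
  have "\<bar>delayed h c w0 w x - delayed h c w0 w y\<bar> \<le> A * P * \<bar>x - y\<bar>"
    if "\<bar>c\<bar> \<le> C" and w: "continuous_on UNIV w" and "x \<le> X" "y \<le> X" for h c w x y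
  proof -
    define v where "v = flux_of c (\<lambda>s. w (s - h))"
    have cv: "continuous_on UNIV v" unfolding v_def by (intro cont_flux_of cont_shift w)
    have "\<bar>v s\<bar> \<le> R" if "s \<le> X" for s
      unfolding v_def using R(2)[OF \<open>\<bar>c\<bar> \<le> C\<close> cont_shift[OF w] that] .
    then have "\<bar>a s * psi (v s)\<bar> \<le> A * P" if "s \<in> {0..X}" for s
      using that A P by (fastforce simp: abs_mult abs_le_iff intro!: mult_mono)
    then have "\<bar>integral {0..x} (\<lambda>s. a s * psi (v s)) - integral {0..y} (\<lambda>s. a s * psi (v s))\<bar>
        \<le> A * P * \<bar>x - y\<bar>"
      using that A P by (intro integral_from_0_lipschitz[of _ X] cont_apsi cv) auto
    then show ?thesis unfolding delayed_def profile_of_def v_def by simp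
  qed
  then show ?thesis by blast
qed

lemma flux_of_tendsto:
  assumes "\<And>n. continuous_on UNIV (g n)" and "\<And>s. s \<in> {0..x} \<Longrightarrow> (\<lambda>n. g n s) \<longlonglongrightarrow> w s" and "c \<longlonglongrightarrow> c0"
  shows "(\<lambda>n. flux_of (c n) (g n) x) \<longlonglongrightarrow> flux_of c0 w x"
proof -
  have Fc: "isCont F y" for y using cont_F by (simp add: continuous_on_eq_continuous_at)
  have "(\<lambda>n. integral {0..x} (\<lambda>s. b s * F (g n s))) \<longlonglongrightarrow> integral {0..x} (\<lambda>s. b s * F (w s))"
  proof (rule dominated_convergence(2))
    show "(\<lambda>s. b s * F (g n s)) integrable_on {0..x}" for n
      by (rule integrable_continuous_real, rule continuous_on_subset[OF cont_bF[OF assms(1)]]) simp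
    show "(\<lambda>s. \<bar>b s\<bar> * M) integrable_on {0..x}"
      by (rule integrable_continuous_real)
         (intro continuous_intros, meson cont_b continuous_on_subset subset_UNIV)
    show "norm (b s * F (g n s)) \<le> \<bar>b s\<bar> * M" for n s
      by (auto simp: abs_mult intro!: mult_left_mono F_bound)
    show "(\<lambda>n. b s * F (g n s)) \<longlonglongrightarrow> b s * F (w s)" if "s \<in> {0..x}" for s
      by (intro tendsto_intros isCont_tendsto_compose[OF Fc] assms(2) that)
  qed
  then show ?thesis unfolding flux_of_def by (intro tendsto_intros assms(3))
qed

lemma profile_of_tendsto:
  assumes "\<And>n. continuous_on UNIV (v n)" and "\<And>n s. s \<le> x \<Longrightarrow> \<bar>v n s\<bar> \<le> R"
    and "\<And>s. s \<in> {0..x} \<Longrightarrow> (\<lambda>n. v n s) \<longlonglongrightarrow> u s"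
  shows "(\<lambda>n. profile_of w0 (v n) x) \<longlonglongrightarrow> profile_of w0 u x"
proof -
  have pc: "isCont psi y" for y using cont_psi by (simp add: continuous_on_eq_continuous_at)
  obtain P where P: "P \<ge> 0" "\<And>s. s \<in> {-R..R} \<Longrightarrow> \<bar>psi s\<bar> \<le> P"
    using continuous_bounded_on_interval[OF cont_psi] by metis
  have "(\<lambda>n. integral {0..x} (\<lambda>s. a s * psi (v n s))) \<longlonglongrightarrow> integral {0..x} (\<lambda>s. a s * psi (u s))"
  proof (rule dominated_convergence(2))
    show "(\<lambda>s. a s * psi (v n s)) integrable_on {0..x}" for n
      by (rule integrable_continuous_real, rule continuous_on_subset[OF cont_apsi[OF assms(1)]]) simp
    show "(\<lambda>s. \<bar>a s\<bar> * P) integrable_on {0..x}"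
      by (rule integrable_continuous_real)
         (intro continuous_intros, meson cont_a continuous_on_subset subset_UNIV)
    show "norm (a s * psi (v n s)) \<le> \<bar>a s\<bar> * P" if "s \<in> {0..x}" for n s
      using assms(2)[of s n] that by (auto simp: abs_mult abs_le_iff intro!: mult_left_mono P)
    show "(\<lambda>n. a s * psi (v n s)) \<longlonglongrightarrow> a s * psi (u s)" if "s \<in> {0..x}" for s
      by (intro tendsto_intros isCont_tendsto_compose[OF pc] assms(3) that)
  qed
  then show ?thesis unfolding profile_of_def by (intro tendsto_intros)
qed

text \<open>The delay makes the value at \<open>x\<close> depend on the profile up to \<open>x - h\<close> only.\<close>

lemma delayed_local:
  assumes "\<And>y. y \<le> x - h \<Longrightarrow> w1 y = w2 y"
  shows "flux_of c (\<lambda>s. w1 (s - h)) x = flux_of c (\<lambda>s. w2 (s - h)) x"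
    and "delayed h c w0 w1 x = delayed h c w0 w2 x"
proof -
  have v: "flux_of c (\<lambda>s. w1 (s - h)) y = flux_of c (\<lambda>s. w2 (s - h)) y" if "y \<le> x" for y
    unfolding flux_of_def using assms that
    by (intro arg_cong2[of _ _ _ _ "(+)"] refl Henstock_Kurzweil_Integration.integral_cong) auto
  show "flux_of c (\<lambda>s. w1 (s - h)) x = flux_of c (\<lambda>s. w2 (s - h)) x" using v by simp
  show "delayed h c w0 w1 x = delayed h c w0 w2 x"
    unfolding delayed_def profile_of_def using v
    by (intro arg_cong2[of _ _ _ _ "(+)"] refl Henstock_Kurzweil_Integration.integral_cong) auto
qed

text \<open>Each further iteration changes nothing on the interval already settled, by causality of the delayed operator.
So the delayed problem is solved on \<open>[0, k h]\<close> after \<open>k\<close> steps.\<close>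

lemma tonelli_fixed_point:
  assumes "h > 0" "x \<le> of_nat k * h"
  shows "delayed h c w0 (tonelli h c w0 k) x = tonelli h c w0 k x"
  using assms(2)
proof (induction k arbitrary: x)
  case 0
  then show ?case by (simp add: tonelli_def delayed_def)
next
  case (Suc k)
  have "delayed h c w0 (tonelli h c w0 k) y = tonelli h c w0 k y" if "y \<le> x - h" for y
    by (rule Suc.IH) (use that Suc.prems in \<open>auto simp: algebra_simps\<close>)
  then have "tonelli h c w0 (Suc k) y = tonelli h c w0 k y" if "y \<le> x - h" for y
    using that by (simp add: tonelli_def)
  then have "delayed h c w0 (tonelli h c w0 (Suc k)) x = delayed h c w0 (tonelli h c w0 k) x"
    by (intro delayed_local) auto
  then show ?case by (simp add: tonelli_def)
qed

text \<open>Delayed solutions are explicit iterates and hence continuous in the initial flux, whereas the undelayed problem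
might lack uniqueness. This is why shooting is done before the delay is removed.\<close>

lemma tonelli_continuous_in_flux:
  assumes "c \<longlonglongrightarrow> c0"
  shows "(\<lambda>n. tonelli h (c n) w0 k x) \<longlonglongrightarrow> tonelli h c0 w0 k x"
proof (induction k arbitrary: x)
  case 0
  then show ?case by (simp add: tonelli_def)
next
  case (Suc k)
  have "Bseq c" using assms by (intro convergent_imp_Bseq) (auto simp: convergent_def)
  then obtain C where C: "\<And>n. \<bar>c n\<bar> \<le> C" unfolding Bseq_def by auto
  define g where "g n s = tonelli h (c n) w0 k (s - h)" for n s
  have cg: "continuous_on UNIV (g n)" for n unfolding g_def by (intro cont_shift cont_tonelli)
  obtain R where R: "\<And>c w y. \<bar>c\<bar> \<le> C \<Longrightarrow> continuous_on UNIV w \<Longrightarrow> y \<le> x \<Longrightarrow> \<bar>flux_of c w y\<bar> \<le> R"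
    using flux_of_local_bound by metis
  have "(\<lambda>n. profile_of w0 (flux_of (c n) (g n)) x) \<longlonglongrightarrow> profile_of w0 (flux_of c0 (\<lambda>s. tonelli h c0 w0 k (s - h))) x"
    by (rule profile_of_tendsto)
       (auto intro!: cont_flux_of cg R C flux_of_tendsto assms simp: Suc.IH g_def[symmetric],
        auto simp: g_def Suc.IH)
  then show ?case
    unfolding tonelli_def funpow.simps o_apply delayed_def g_def[abs_def] .
qed

text \<open>The \<open>n\<close>-th approximation has delay \<open>1/(n+1)\<close> and solves its equation up to \<open>n + 1\<close>, so a single limit yields
a solution on the whole half-line.\<close>
definition approx :: "(nat \<Rightarrow> real) \<Rightarrow> real \<Rightarrow> nat \<Rightarrow> real \<Rightarrow> real" where
  "approx c w0 n = tonelli (1 / real (Suc n)) (c n) w0 (Suc n * Suc n)"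

lemma approx_delayed:
  assumes "x \<le> real (Suc n)"
  shows "delayed (1 / real (Suc n)) (c n) w0 (approx c w0 n) x = approx c w0 n x"
proof -
  have "real (Suc n * Suc n) * (1 / real (Suc n)) = real (Suc n)"
    unfolding of_nat_mult by (simp del: of_nat_Suc)
  then show ?thesis unfolding approx_def using assms by (intro tonelli_fixed_point) auto
qed

text \<open>Peano's existence theorem with varying initial fluxes. Common local Lipschitz bounds give a convergent
subsequence, they make the shift by the vanishing delay harmless, and dominated convergence identifies the limit as a
solution of the undelayed integral equations.\<close>

theorem approximations_converge:
  fixes c :: "nat \<Rightarrow> real"
  assumes C: "\<And>n. \<bar>c n\<bar> \<le> C"
  obtains r c0 W where "strict_mono (r :: nat \<Rightarrow> nat)" "(\<lambda>n. c (r n)) \<longlonglongrightarrow> c0"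
    "continuous_on UNIV W" "W = profile_of w0 (flux_of c0 W)"
    "\<And>x. (\<lambda>n. approx c w0 (r n) x) \<longlonglongrightarrow> W x"
    "\<And>x. (\<lambda>n. flux_of (c (r n)) (\<lambda>s. approx c w0 (r n) (s - 1 / real (Suc (r n)))) x) \<longlonglongrightarrow> flux_of c0 W x"
proof -
  define h where "h n = 1 / real (Suc n)" for n
  have h: "h n > 0" for n by (simp add: h_def)
  have ca: "continuous_on UNIV (approx c w0 n)" for n unfolding approx_def by (rule cont_tonelli)
  have form: "\<exists>u. continuous_on UNIV u \<and> approx c w0 n = delayed (h n) (c n) w0 u" for n
  proof -
    have "tonelli (h n) (c n) w0 (Suc n * Suc n)
        = delayed (h n) (c n) w0 (tonelli (h n) (c n) w0 (n + n * Suc n))"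
      by (simp add: tonelli_def)
    then show ?thesis unfolding approx_def h_def[symmetric] using cont_tonelli by blast
  qed
  have lip: "\<exists>L. \<forall>n. \<forall>x\<le>X. \<forall>y\<le>X. \<bar>approx c w0 n x - approx c w0 n y\<bar> \<le> L * \<bar>x - y\<bar>" for X
  proof -
    obtain L where L: "\<And>h c w x y. \<bar>c\<bar> \<le> C \<Longrightarrow> continuous_on UNIV w \<Longrightarrow> x \<le> X \<Longrightarrow> y \<le> X \<Longrightarrow>
        \<bar>delayed h c w0 w x - delayed h c w0 w y\<bar> \<le> L * \<bar>x - y\<bar>"
      using delayed_lipschitz[of C X w0] by blast
    show ?thesis using L[OF C] form by metis
  qed
  obtain r1 c0 where r1: "strict_mono (r1 :: nat \<Rightarrow> nat)" "(\<lambda>n. c (r1 n)) \<longlonglongrightarrow> c0"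
  proof -
    have "bounded (range c)" unfolding bounded_iff using C by auto
    then obtain l r where "strict_mono r" "(c \<circ> r) \<longlonglongrightarrow> l"
      using bounded_imp_convergent_subsequence by blast
    then show ?thesis using that by (auto simp: o_def)
  qed
  obtain r2 W where r2: "strict_mono (r2 :: nat \<Rightarrow> nat)" "\<And>x. (\<lambda>n. approx c w0 (r1 (r2 n)) x) \<longlonglongrightarrow> W x"
  proof (rule pointwise_convergent_subsequence_of_locally_lipschitz[of "\<lambda>n. approx c w0 (r1 n)" w0])
    show "\<exists>L. \<forall>n. \<forall>x\<le>X. \<forall>y\<le>X. \<bar>approx c w0 (r1 n) x - approx c w0 (r1 n) y\<bar> \<le> L * \<bar>x - y\<bar>" for X
      using lip[of X] by blast
    show "approx c w0 (r1 n) 0 = w0" for n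
      using form[of "r1 n"] by (auto simp: delayed_def)
  qed blast
  define r where "r = r1 \<circ> r2"
  have r: "strict_mono r" unfolding r_def using r1(1) r2(1) by (rule strict_mono_o)
  have cr: "(\<lambda>n. c (r n)) \<longlonglongrightarrow> c0"
    using LIMSEQ_subseq_LIMSEQ[OF r1(2) r2(1)] by (simp add: r_def o_def)
  have Wr: "(\<lambda>n. approx c w0 (r n) x) \<longlonglongrightarrow> W x" for x using r2(2) by (simp add: r_def)
  have hr: "(\<lambda>n. h (r n)) \<longlonglongrightarrow> 0"
    using LIMSEQ_subseq_LIMSEQ[OF LIMSEQ_Suc[OF lim_1_over_n] r] by (simp add: h_def o_def)
  have cW: "continuous_on UNIV W"
  proof (rule locally_lipschitz_continuous)
    fix X
    obtain L where L: "\<And>n x y. x \<le> X \<Longrightarrow> y \<le> X \<Longrightarrow> \<bar>approx c w0 n x - approx c w0 n y\<bar> \<le> L * \<bar>x - y\<bar>"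
      using lip[of X] by blast
    have "\<bar>W x - W y\<bar> \<le> L * \<bar>x - y\<bar>" if "x \<le> X" "y \<le> X" for x y
    proof (rule LIMSEQ_le_const2)
      show "(\<lambda>n. \<bar>approx c w0 (r n) x - approx c w0 (r n) y\<bar>) \<longlonglongrightarrow> \<bar>W x - W y\<bar>"
        by (intro tendsto_intros Wr)
    qed (use L that in auto)
    then show "\<exists>L. \<forall>x\<le>X. \<forall>y\<le>X. \<bar>W x - W y\<bar> \<le> L * \<bar>x - y\<bar>" by blast
  qed
  have shift: "(\<lambda>n. approx c w0 (r n) (x - h (r n))) \<longlonglongrightarrow> W x" for x
  proof -
    obtain L where L: "\<And>n u v. u \<le> x \<Longrightarrow> v \<le> x \<Longrightarrow> \<bar>approx c w0 n u - approx c w0 n v\<bar> \<le> L * \<bar>u - v\<bar>"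
      using lip[of x] by blast
    have "(\<lambda>n. approx c w0 (r n) (x - h (r n)) - approx c w0 (r n) x) \<longlonglongrightarrow> 0"
    proof (rule Lim_null_comparison)
      have "\<bar>approx c w0 (r n) (x - h (r n)) - approx c w0 (r n) x\<bar> \<le> L * h (r n)" for n
        using L[of "x - h (r n)" x "r n"] h[of "r n"] by simp
      then show "\<forall>\<^sub>F n in sequentially. norm (approx c w0 (r n) (x - h (r n)) - approx c w0 (r n) x) \<le> L * h (r n)"
        by simp
      have "(\<lambda>n. L * h (r n)) \<longlonglongrightarrow> L * 0" by (intro tendsto_intros hr)
      then show "(\<lambda>n. L * h (r n)) \<longlonglongrightarrow> 0" by simp
    qed
    from tendsto_add[OF this Wr[of x]] show ?thesis by simp
  qed
  have vlim: "(\<lambda>n. flux_of (c (r n)) (\<lambda>s. approx c w0 (r n) (s - h (r n))) x) \<longlonglongrightarrow> flux_of c0 W x" for x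
    by (intro flux_of_tendsto cont_shift ca shift cr)
  have "W x = profile_of w0 (flux_of c0 W) x" for x
  proof -
    obtain R where R: "\<And>c w y. \<bar>c\<bar> \<le> C \<Longrightarrow> continuous_on UNIV w \<Longrightarrow> y \<le> x \<Longrightarrow> \<bar>flux_of c w y\<bar> \<le> R"
      using flux_of_local_bound by metis
    have "(\<lambda>n. delayed (h (r n)) (c (r n)) w0 (approx c w0 (r n)) x) \<longlonglongrightarrow> profile_of w0 (flux_of c0 W) x"
      unfolding delayed_def
      by (rule profile_of_tendsto) (auto intro!: cont_flux_of cont_shift ca R C vlim)
    moreover have "\<forall>\<^sub>F n in sequentially.
        delayed (h (r n)) (c (r n)) w0 (approx c w0 (r n)) x = approx c w0 (r n) x"
    proof -
      obtain K :: nat where K: "x \<le> real K" using real_arch_simple by blast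
      have "x \<le> real (Suc (r n))" if "n \<ge> K" for n
      proof -
        have "K \<le> r n" using that seq_suble[OF r, of n] by linarith
        then have "real K \<le> real (Suc (r n))" by simp
        with K show ?thesis by linarith
      qed
      then show ?thesis unfolding h_def eventually_sequentially using approx_delayed by blast
    qed
    ultimately have "(\<lambda>n. approx c w0 (r n) x) \<longlonglongrightarrow> profile_of w0 (flux_of c0 W) x"
      by (rule Lim_transform_eventually)
    with Wr show ?thesis using LIMSEQ_unique by blast
  qed
  then have "W = profile_of w0 (flux_of c0 W)" by blast
  from that[OF r cr cW this Wr vlim[unfolded h_def]] show ?thesis .
qed

end

section \<open>The equation as a first-order system\<close>

definition signed_powr :: "real \<Rightarrow> real \<Rightarrow> real" where
  "signed_powr \<theta> s = sgn s * \<bar>s\<bar> powr \<theta>"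

lemma signed_powr_pos: "s > 0 \<Longrightarrow> signed_powr \<theta> s = s powr \<theta>"
  by (simp add: signed_powr_def)

lemma signed_powr_0 [simp]: "signed_powr \<theta> 0 = 0"
  by (simp add: signed_powr_def)

lemma signed_powr_uminus [simp]: "signed_powr \<theta> (- s) = - signed_powr \<theta> s"
  by (simp add: signed_powr_def sgn_minus)

lemma signed_powr_neg: "s < 0 \<Longrightarrow> signed_powr \<theta> s = - ((- s) powr \<theta>)"
  by (simp add: signed_powr_def)

lemma signed_powr_signed_powr: "\<theta> \<noteq> 0 \<Longrightarrow> signed_powr (1 / \<theta>) (signed_powr \<theta> s) = s"
  by (cases s "0 :: real" rule: linorder_cases) (auto simp: signed_powr_def powr_powr abs_mult)

lemma signed_powr_mult: "t > 0 \<Longrightarrow> signed_powr \<theta> (t * s) = t powr \<theta> * signed_powr \<theta> s"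
  by (simp add: signed_powr_def sgn_mult abs_mult powr_mult)

lemma signed_powr_less: "\<theta> > 0 \<Longrightarrow> x < y \<Longrightarrow> signed_powr \<theta> x < signed_powr \<theta> y"
proof (cases x "0 :: real" rule: linorder_cases)
  case less
  assume "\<theta> > 0" "x < y"
  then show ?thesis using less
    by (cases y "0 :: real" rule: linorder_cases) (auto simp: signed_powr_def intro: powr_less_mono2 less_trans[of _ 0])
qed (auto simp: signed_powr_def intro: powr_less_mono2)

lemma signed_powr_le: "\<theta> > 0 \<Longrightarrow> x \<le> y \<Longrightarrow> signed_powr \<theta> x \<le> signed_powr \<theta> y"
  using signed_powr_less[of \<theta> x y] by (cases "x = y") auto

lemma continuous_on_signed_powr: "\<theta> > 0 \<Longrightarrow> continuous_on UNIV (signed_powr \<theta>)"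
proof -
  assume t: "\<theta> > 0"
  have "signed_powr \<theta> = (\<lambda>s. max s 0 powr \<theta> - max (- s) 0 powr \<theta>)"
  proof
    fix s :: real
    show "signed_powr \<theta> s = max s 0 powr \<theta> - max (- s) 0 powr \<theta>"
      by (cases s "0 :: real" rule: linorder_cases) (auto simp: signed_powr_def max_def)
  qed
  moreover have "continuous_on UNIV (\<lambda>s :: real. max s 0 powr \<theta> - max (- s) 0 powr \<theta>)"
    using t by (intro continuous_intros continuous_on_powr') auto
  ultimately show ?thesis by simp
qed

lemma flux_eq_signed_powr: "flux p s = signed_powr (p - 1) s"
proof (cases "s = 0")
  case False
  then have "\<bar>s\<bar> powr (p - 1) = \<bar>s\<bar> powr (p - 2) * \<bar>s\<bar>"
    using powr_add[of "\<bar>s\<bar>" "p - 2" 1] by simp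
  then show ?thesis by (simp add: flux_def signed_powr_def sgn_if)
qed (simp add: flux_def)

text \<open>Here \<open>u\<close> is the weighted flux \<open>r\<^bsup>N-1\<^esup> |w'|\<^bsup>p-2\<^esup> w'\<close>, for which the lower-order term of the equation
disappears.\<close>
definition first_order_solution ::
  "real \<Rightarrow> real \<Rightarrow> real \<Rightarrow> real \<Rightarrow> real \<Rightarrow> real set \<Rightarrow> (real \<Rightarrow> real) \<Rightarrow> (real \<Rightarrow> real) \<Rightarrow> bool" where
  "first_order_solution N p q \<sigma> \<epsilon> I w u \<longleftrightarrow> (\<forall>r\<in>I. w r > 0 \<and>
     (w has_real_derivative r powr (- ((N - 1) / (p - 1))) * signed_powr (1 / (p - 1)) (u r)) (at r) \<and>
     (u has_real_derivative - \<epsilon> * r powr (N + \<sigma> - 1) * w r powr q) (at r))"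

lemma positive_solution_imp_first_order:
  assumes p: "p > 1" and I: "open I" "I \<subseteq> {0<..}" and sol: "positive_solution N p q \<sigma> \<epsilon> I w"
  shows "first_order_solution N p q \<sigma> \<epsilon> I w (\<lambda>r. r powr (N - 1) * flux p (deriv w r))"
  unfolding first_order_solution_def
proof (intro ballI conjI)
  fix r assume r: "r \<in> I"
  then have r0: "r > 0" using I by auto
  from sol r have s: "w r > 0" "w differentiable (at r)" "(\<lambda>s. flux p (deriv w s)) differentiable (at r)"
    "- deriv (\<lambda>s. flux p (deriv w s)) r - (N - 1) / r * flux p (deriv w r) = \<epsilon> * r powr \<sigma> * w r powr q"
    unfolding positive_solution_def by auto
  show "w r > 0" by (rule s(1))
  have "(w has_real_derivative deriv w r) (at r)"
    using s(2) by (metis DERIV_imp_deriv real_differentiable_def)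
  moreover have "r powr (- ((N - 1) / (p - 1))) * signed_powr (1 / (p - 1)) (r powr (N - 1) * flux p (deriv w r)) = deriv w r"
    using p r0 signed_powr_signed_powr[of "p - 1" "deriv w r"]
    by (simp add: signed_powr_mult flux_eq_signed_powr powr_powr powr_minus field_simps)
  ultimately show "(w has_real_derivative r powr (- ((N - 1) / (p - 1))) *
      signed_powr (1 / (p - 1)) (r powr (N - 1) * flux p (deriv w r))) (at r)" by simp
  have d: "((\<lambda>s. flux p (deriv w s)) has_real_derivative deriv (\<lambda>s. flux p (deriv w s)) r) (at r)"
    using s(3) by (metis DERIV_imp_deriv real_differentiable_def)
  have e: "deriv (\<lambda>s. flux p (deriv w s)) r = - \<epsilon> * r powr \<sigma> * w r powr q - (N - 1) / r * flux p (deriv w r)"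
    using s(4) by linarith
  have powers: "r powr (N - 1) / r = r powr (N - 2)" "r powr (N - 1) * r powr \<sigma> = r powr (N + \<sigma> - 1)"
    using r0 powr_diff[of r "N - 1" 1] powr_add[of r "N - 1" \<sigma>] by (auto simp: algebra_simps)
  have "((\<lambda>r. r powr (N - 1) * flux p (deriv w r)) has_real_derivative
      (N - 1) * r powr (N - 1 - 1) * flux p (deriv w r)
      + deriv (\<lambda>s. flux p (deriv w s)) r * r powr (N - 1)) (at r)"
    by (rule DERIV_mult[OF has_real_derivative_powr[OF r0] d])
  also have "(N - 1) * r powr (N - 1 - 1) * flux p (deriv w r)
      + deriv (\<lambda>s. flux p (deriv w s)) r * r powr (N - 1)
      = (N - 1) * flux p (deriv w r) * (r powr (N - 2) - r powr (N - 1) / r)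
        - \<epsilon> * (r powr (N - 1) * r powr \<sigma>) * w r powr q"
    unfolding e by (simp add: algebra_simps diff_divide_distrib)
  also have "\<dots> = - \<epsilon> * r powr (N + \<sigma> - 1) * w r powr q"
    unfolding powers by simp
  finally show "((\<lambda>r. r powr (N - 1) * flux p (deriv w r)) has_real_derivative
      - \<epsilon> * r powr (N + \<sigma> - 1) * w r powr q) (at r)" .
qed

lemma first_order_imp_positive_solution:
  assumes p: "p > 1" and I: "open I" "I \<subseteq> {0<..}" and sol: "first_order_solution N p q \<sigma> \<epsilon> I w u"
  shows "positive_solution N p q \<sigma> \<epsilon> I w"
  unfolding positive_solution_def
proof (intro ballI conjI)
  fix r assume r: "r \<in> I"
  then have r0: "r > 0" using I by auto
  have s: "w t > 0"
      "(w has_real_derivative t powr (- ((N - 1) / (p - 1))) * signed_powr (1 / (p - 1)) (u t)) (at t)"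
      "(u has_real_derivative - \<epsilon> * t powr (N + \<sigma> - 1) * w t powr q) (at t)" if "t \<in> I" for t
    using sol that unfolding first_order_solution_def by auto
  show "w r > 0" using s r by auto
  show "w differentiable (at r)" using s(2)[OF r] real_differentiable_def by blast
  have f: "flux p (deriv w t) = t powr (1 - N) * u t" if "t \<in> I" for t
  proof -
    have t0: "t > 0" using that I by auto
    have "flux p (deriv w t) = signed_powr (p - 1) (t powr (- ((N - 1) / (p - 1))) * signed_powr (1 / (p - 1)) (u t))"
      using DERIV_imp_deriv[OF s(2)[OF that]] by (simp add: flux_eq_signed_powr)
    also have "\<dots> = t powr (- (N - 1)) * u t"
      using p t0 signed_powr_signed_powr[of "1 / (p - 1)" "u t"] by (simp add: signed_powr_mult powr_powr)
    finally show ?thesis by simp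
  qed
  have powers: "r powr (1 - N - 1) = r powr (1 - N) / r" "r powr (1 - N) * r powr (N + \<sigma> - 1) = r powr \<sigma>"
    using r0 powr_diff[of r "1 - N" 1] powr_add[of r "1 - N" "N + \<sigma> - 1"] by (auto simp: algebra_simps)
  have "((\<lambda>t. t powr (1 - N) * u t) has_real_derivative
      (1 - N) * r powr (1 - N - 1) * u r + - \<epsilon> * r powr (N + \<sigma> - 1) * w r powr q * r powr (1 - N)) (at r)"
    by (rule DERIV_mult[OF has_real_derivative_powr[OF r0] s(3)[OF r]])
  also have "(1 - N) * r powr (1 - N - 1) * u r + - \<epsilon> * r powr (N + \<sigma> - 1) * w r powr q * r powr (1 - N)
     = (1 - N) / r * (r powr (1 - N) * u r) - \<epsilon> * (r powr (1 - N) * r powr (N + \<sigma> - 1)) * w r powr q"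
    unfolding powers(1) by (simp add: algebra_simps)
  also have "\<dots> = (1 - N) / r * flux p (deriv w r) - \<epsilon> * r powr \<sigma> * w r powr q"
    unfolding powers(2) f[OF r] by simp
  finally have "((\<lambda>t. t powr (1 - N) * u t) has_real_derivative
      (1 - N) / r * flux p (deriv w r) - \<epsilon> * r powr \<sigma> * w r powr q) (at r)" .
  then have D: "((\<lambda>t. flux p (deriv w t)) has_real_derivative
      (1 - N) / r * flux p (deriv w r) - \<epsilon> * r powr \<sigma> * w r powr q) (at r)"
    by (rule has_field_derivative_transform_within_open[OF _ I(1) r]) (simp add: f)
  show "(\<lambda>s. flux p (deriv w s)) differentiable (at r)" using D real_differentiable_def by blast
  show "- deriv (\<lambda>s. flux p (deriv w s)) r - (N - 1) / r * flux p (deriv w r) = \<epsilon> * r powr \<sigma> * w r powr q"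
    unfolding DERIV_imp_deriv[OF D] by (simp add: algebra_simps diff_divide_distrib)
qed

lemma first_order_deriv:
  assumes "first_order_solution N p q \<sigma> \<epsilon> I w u" "r \<in> I"
  shows "deriv w r = r powr (- ((N - 1) / (p - 1))) * signed_powr (1 / (p - 1)) (u r)"
  using assms unfolding first_order_solution_def by (auto intro: DERIV_imp_deriv)

section \<open>Nonexistence near infinity\<close>

text \<open>The common source of all contradictions at infinity: \<open>f - (c/\<alpha>) r\<^bsup>\<alpha>\<^esup>\<close> is nondecreasing.\<close>

lemma power_growth_unbounded:
  fixes f :: "real \<Rightarrow> real"
  assumes "c > 0" "\<alpha> > 0" "R \<ge> 0"
    and D: "\<And>r. r > R \<Longrightarrow> (f has_real_derivative f' r) (at r)"
    and ge: "\<And>r. r > R \<Longrightarrow> f' r \<ge> c * r powr (\<alpha> - 1)"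
  shows "filterlim f at_top at_top"
proof -
  define s where "s = R + 1"
  have low: "f s + c / \<alpha> * (r powr \<alpha> - s powr \<alpha>) \<le> f r" if "r \<ge> s" for r
  proof -
    have "f s - c / \<alpha> * s powr \<alpha> \<le> f r - c / \<alpha> * r powr \<alpha>"
    proof (rule DERIV_nonneg_imp_nondecreasing[OF that])
      fix x assume "s \<le> x" "x \<le> r"
      then have x: "x > 0" "x > R" using assms by (auto simp: s_def)
      have "((\<lambda>r. f r - c / \<alpha> * r powr \<alpha>) has_real_derivative f' x - c / \<alpha> * (\<alpha> * x powr (\<alpha> - 1))) (at x)"
        by (intro DERIV_diff D x DERIV_cmult has_real_derivative_powr)
      moreover have "f' x - c / \<alpha> * (\<alpha> * x powr (\<alpha> - 1)) \<ge> 0" using ge[OF x(2)] assms by simp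
      ultimately show "\<exists>y. ((\<lambda>r. f r - c / \<alpha> * r powr \<alpha>) has_real_derivative y) (at x) \<and> 0 \<le> y" by blast
    qed
    then show ?thesis unfolding right_diff_distrib by linarith
  qed
  have "filterlim (\<lambda>r. r powr \<alpha>) at_top at_top"
  proof (rule filterlim_at_top_mono)
    show "filterlim (\<lambda>r. exp (\<alpha> * ln r)) at_top at_top"
      using \<open>\<alpha> > 0\<close> by (intro filterlim_compose[OF exp_at_top]
        filterlim_tendsto_pos_mult_at_top[OF tendsto_const _ ln_at_top])
    show "\<forall>\<^sub>F r in at_top. exp (\<alpha> * ln r) \<le> r powr \<alpha>"
      using eventually_gt_at_top[of 0] by eventually_elim (simp add: powr_def)
  qed
  then have "filterlim (\<lambda>r. (f s - c / \<alpha> * s powr \<alpha>) + c / \<alpha> * r powr \<alpha>) at_top at_top"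
    using assms by (intro filterlim_tendsto_add_at_top[OF tendsto_const] filterlim_tendsto_pos_mult_at_top[OF tendsto_const]) auto
  then show ?thesis
    by (rule filterlim_at_top_mono, use eventually_ge_at_top[of s] in eventually_elim, use low in \<open>simp add: right_diff_distrib algebra_simps\<close>)
qed

text \<open>A flux below \<open>- \<kappa>\<close> makes \<open>w\<close> drop at least at the rate \<open>r\<^bsup>(p-N)/(p-1) - 1\<^esup>\<close>, which is not integrable at
infinity because \<open>p > N\<close>.\<close>

lemma flux_not_uniformly_negative:
  assumes p: "p > 1" "p > N" and "R \<ge> 0" and sol: "first_order_solution N p q \<sigma> \<epsilon> {R<..} w u"
    and "\<kappa> > 0" and neg: "\<And>r. r > R \<Longrightarrow> u r \<le> - \<kappa>"
  shows False
proof -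
  have "filterlim (\<lambda>r. - w r) at_top at_top"
  proof (rule power_growth_unbounded)
    show "\<kappa> powr (1 / (p - 1)) > 0" "(p - N) / (p - 1) > 0" "R \<ge> 0" using assms by auto
    fix r assume r: "r > R"
    then show "((\<lambda>r. - w r) has_real_derivative
        - (r powr (- ((N - 1) / (p - 1))) * signed_powr (1 / (p - 1)) (u r))) (at r)"
      using sol unfolding first_order_solution_def by (auto intro: DERIV_minus)
    have "signed_powr (1 / (p - 1)) (u r) \<le> signed_powr (1 / (p - 1)) (- \<kappa>)"
      using p by (intro signed_powr_le neg r) auto
    then have s: "\<kappa> powr (1 / (p - 1)) \<le> - signed_powr (1 / (p - 1)) (u r)"
      using \<open>\<kappa> > 0\<close> by (simp add: signed_powr_pos)
    have "(p - N) / (p - 1) - 1 = - ((N - 1) / (p - 1))" using p by (simp add: field_simps)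
    then show "- (r powr (- ((N - 1) / (p - 1))) * signed_powr (1 / (p - 1)) (u r))
        \<ge> \<kappa> powr (1 / (p - 1)) * r powr ((p - N) / (p - 1) - 1)"
      using mult_left_mono[OF s, of "r powr (- ((N - 1) / (p - 1)))"] by (simp add: mult.commute)
  qed
  then have "\<forall>\<^sub>F r in at_top. - w r \<ge> 0" unfolding filterlim_at_top by blast
  moreover have "\<forall>\<^sub>F r in at_top. w r > 0"
    using eventually_gt_at_top[of R] by eventually_elim (use sol in \<open>auto simp: first_order_solution_def\<close>)
  ultimately have "\<forall>\<^sub>F r in at_top :: real filter. False" by eventually_elim auto
  then show False by simp
qed

text \<open>The flux decreases. It cannot become negative by the previous lemma, so \<open>w\<close> is nondecreasing; but then the
source term \<open>r\<^bsup>N+\<sigma>-1\<^esup> w\<^bsup>q\<^esup>\<close> has infinite integral, since \<open>N + \<sigma> > 0\<close>, and drives the flux to \<open>- \<infinity>\<close>.\<close>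

lemma no_positive_solution_near_infinity:
  assumes p: "p > 1" "p > N" "N > - \<sigma>" and "q > 0" and "R \<ge> 0"
  shows "\<not> positive_solution N p q \<sigma> 1 {R<..} w"
proof
  assume "positive_solution N p q \<sigma> 1 {R<..} w"
  then obtain u where sol: "first_order_solution N p q \<sigma> 1 {R<..} w u"
    using positive_solution_imp_first_order[of p "{R<..}"] p \<open>R \<ge> 0\<close> by fastforce
  have w: "w r > 0" and Dw: "(w has_real_derivative r powr (- ((N - 1) / (p - 1))) * signed_powr (1 / (p - 1)) (u r)) (at r)"
    and Du: "(u has_real_derivative - 1 * r powr (N + \<sigma> - 1) * w r powr q) (at r)" if "r > R" for r
    using sol that unfolding first_order_solution_def by auto
  have u_mono: "u t \<le> u s" if "R < s" "s \<le> t" for s t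
  proof (rule DERIV_nonpos_imp_nonincreasing[OF that(2)])
    fix x assume "s \<le> x" "x \<le> t"
    then have "x > R" using that by simp
    then show "\<exists>y. (u has_real_derivative y) (at x) \<and> y \<le> 0"
      by (intro exI conjI, rule Du) auto
  qed
  have u_nonneg: "u r \<ge> 0" if "r > R" for r
  proof (rule ccontr)
    assume "\<not> u r \<ge> 0"
    show False
    proof (rule flux_not_uniformly_negative[of p N r q \<sigma> 1 w u "- u r"])
      show "first_order_solution N p q \<sigma> 1 {r<..} w u"
        using sol that unfolding first_order_solution_def by auto
      show "u s \<le> - (- u r)" if "s > r" for s using u_mono[of r s] that \<open>r > R\<close> by auto
    qed (use that p \<open>R \<ge> 0\<close> \<open>\<not> u r \<ge> 0\<close> in auto)
  qed
  define s where "s = R + 1"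
  have w_mono: "w s \<le> w r" if "s \<le> r" for r
  proof (rule DERIV_nonneg_imp_nondecreasing[OF that])
    fix x assume "s \<le> x" "x \<le> r"
    then have x: "x > R" by (simp add: s_def)
    have "signed_powr (1 / (p - 1)) (u x) \<ge> 0"
      using u_nonneg[OF x] by (simp add: signed_powr_def zero_le_mult_iff)
    then have "0 \<le> x powr (- ((N - 1) / (p - 1))) * signed_powr (1 / (p - 1)) (u x)" by simp
    with Dw[OF x] show "\<exists>y. (w has_real_derivative y) (at x) \<and> 0 \<le> y" by blast
  qed
  have "filterlim (\<lambda>r. - u r) at_top at_top"
  proof (rule power_growth_unbounded[of "w s powr q" "N + \<sigma>" s])
    show "w s powr q > 0" "N + \<sigma> > 0" "s \<ge> 0" using w[of s] p \<open>R \<ge> 0\<close> by (auto simp: s_def)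
    fix r assume r: "r > s"
    then have rR: "r > R" by (simp add: s_def)
    show "((\<lambda>r. - u r) has_real_derivative r powr (N + \<sigma> - 1) * w r powr q) (at r)"
      using DERIV_minus[OF Du[OF rR]] by simp
    have "w s powr q \<le> w r powr q"
      using w_mono[of r] w[of s] r \<open>q > 0\<close> by (intro powr_mono2) (auto simp: s_def)
    then show "r powr (N + \<sigma> - 1) * w r powr q \<ge> w s powr q * r powr (N + \<sigma> - 1)"
      using mult_left_mono[of _ _ "r powr (N + \<sigma> - 1)"] by (simp add: mult.commute)
  qed
  then have "\<forall>\<^sub>F r in at_top. - u r \<ge> 1" unfolding filterlim_at_top by blast
  moreover have "\<forall>\<^sub>F r in at_top. u r \<ge> 0"
    using eventually_gt_at_top[of R] by eventually_elim (rule u_nonneg)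
  ultimately have "\<forall>\<^sub>F r in at_top :: real filter. False" by eventually_elim auto
  then show False by simp
qed

section \<open>The explicit singular solution\<close>

lemma gam_pos:
  assumes "q > p - 1" "p > N" "N > - \<sigma>"
  shows "gam p q \<sigma> > 0"
  using assms unfolding gam_def by (intro divide_pos_pos) auto

lemma astar_eq:
  assumes "q > p - 1" "p > 1" "p > N" "N > - \<sigma>"
  defines "g \<equiv> gam p q \<sigma>"
  shows "astar N p q \<sigma> = (g powr (p - 1) * (p - N + (p - 1) * g)) powr (1 / (q - p + 1))"
proof -
  have g: "g > 0" unfolding g_def using assms by (intro gam_pos) auto
  define K where "K = g powr (p - 1) * (p - N + (p - 1) * g)"
  have K: "K > 0" unfolding K_def using g assms by (intro mult_pos_pos add_pos_pos) auto
  have "g powr (p - 1) = g powr (p - 2) * g" using g powr_add[of g "p - 2" 1] by simp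
  then have rhs: "(-1) * (\<bar>g\<bar> powr (p - 2) * g * (N - p - (p - 1) * g)) = K"
    using g by (simp add: K_def algebra_simps)
  have "astar N p q \<sigma> = (THE a. a > 0 \<and> a powr (q - p + 1) = K)"
    unfolding astar_def g_def[symmetric] rhs ..
  also have "\<dots> = K powr (1 / (q - p + 1))"
  proof (rule the_equality)
    show "K powr (1 / (q - p + 1)) > 0 \<and> (K powr (1 / (q - p + 1))) powr (q - p + 1) = K"
      using K assms by (simp add: powr_powr)
    fix a assume "a > 0 \<and> a powr (q - p + 1) = K"
    then show "a = K powr (1 / (q - p + 1))" using assms by (auto simp: powr_powr)
  qed
  finally show ?thesis unfolding K_def .
qed

text \<open>With \<open>A = a*\<close> and \<open>E = N - p - \<gamma> (p - 1)\<close>, both equations reduce to an identity of powers of \<open>r\<close>,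
namely \<open>\<gamma> (q - p + 1) = p + \<sigma>\<close>, and the identity \<open>A\<^bsup>q\<^esup> = - E (A \<gamma>)\<^bsup>p-1\<^esup>\<close> of coefficients.\<close>

lemma wstar_first_order:
  assumes q: "q > p - 1" and p: "p > 1" "p > N" and s: "N > - \<sigma>"
  defines "g \<equiv> gam p q \<sigma>" and "A \<equiv> astar N p q \<sigma>"
  shows "first_order_solution N p q \<sigma> (-1) {0<..} (wstar N p q \<sigma>)
      (\<lambda>r. - ((A * g) powr (p - 1)) * r powr (N - p - g * (p - 1)))"
proof -
  have g: "g > 0" unfolding g_def using assms by (intro gam_pos) auto
  define K where "K = g powr (p - 1) * (p - N + (p - 1) * g)"
  have K: "K > 0" unfolding K_def using g assms by (intro mult_pos_pos add_pos_pos) auto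
  have A: "A = K powr (1 / (q - p + 1))" unfolding A_def K_def g_def using assms by (intro astar_eq) auto
  have Apos: "A > 0" using A K by simp
  have AK: "A powr (q - p + 1) = K" using A K q by (simp add: powr_powr)
  define E where "E = N - p - g * (p - 1)"
  have gq: "g * (q - p + 1) = p + \<sigma>" using q unfolding g_def gam_def by (simp add: field_simps)
  have ws: "wstar N p q \<sigma> r = A * r powr (- g)" for r
    unfolding wstar_def A_def g_def gam_def ..
  have Aq: "A powr q = - ((A * g) powr (p - 1) * E)"
  proof -
    have "A powr q = A powr (p - 1) * A powr (q - p + 1)" using Apos by (simp add: powr_add[symmetric])
    also have "\<dots> = (A * g) powr (p - 1) * (p - N + (p - 1) * g)"
      unfolding AK K_def using Apos g by (simp add: powr_mult)
    finally show ?thesis unfolding E_def by (simp add: algebra_simps)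
  qed
  show ?thesis
    unfolding first_order_solution_def E_def[symmetric]
  proof (intro ballI conjI)
    fix r :: real assume "r \<in> {0<..}"
    then have r: "r > 0" by simp
    show "wstar N p q \<sigma> r > 0" unfolding ws using Apos r by simp
    have e1: "r powr (- ((N - 1) / (p - 1))) * signed_powr (1 / (p - 1)) (- ((A * g) powr (p - 1)) * r powr E)
        = A * (- g * r powr (- g - 1))"
    proof -
      have ex: "- ((N - 1) / (p - 1)) + E / (p - 1) = - g - 1"
      proof -
        have "E / (p - 1) = (N - p) / (p - 1) - g" using p by (simp add: E_def diff_divide_distrib)
        moreover have "(N - p) / (p - 1) = (N - 1) / (p - 1) - 1" using p by (simp add: field_simps)
        ultimately show ?thesis by simp
      qed
      have "signed_powr (1 / (p - 1)) (- ((A * g) powr (p - 1)) * r powr E) = - (A * g * r powr (E / (p - 1)))"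
        using Apos g r p by (subst signed_powr_neg) (auto simp: powr_mult powr_powr)
      moreover have "r powr (- ((N - 1) / (p - 1))) * r powr (E / (p - 1)) = r powr (- g - 1)"
        unfolding ex[symmetric] powr_add ..
      ultimately show ?thesis by (metis (no_types, lifting) mult.assoc mult.left_commute mult_minus_left mult_minus_right)
    qed
    show "(wstar N p q \<sigma> has_real_derivative r powr (- ((N - 1) / (p - 1))) *
        signed_powr (1 / (p - 1)) (- ((A * g) powr (p - 1)) * r powr E)) (at r)"
      unfolding e1 ws[abs_def] by (intro DERIV_cmult has_real_derivative_powr r)
    have e2: "- (-1) * r powr (N + \<sigma> - 1) * wstar N p q \<sigma> r powr q
        = - ((A * g) powr (p - 1)) * (E * r powr (E - 1))"
    proof -
      have ex: "N + \<sigma> - 1 + - g * q = E - 1" using gq unfolding E_def by (simp add: algebra_simps)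
      have "wstar N p q \<sigma> r powr q = A powr q * r powr (- g * q)"
        unfolding ws using Apos r by (simp add: powr_mult powr_powr)
      then have "- (-1) * r powr (N + \<sigma> - 1) * wstar N p q \<sigma> r powr q = A powr q * r powr (E - 1)"
        unfolding ex[symmetric] powr_add by simp
      then show ?thesis unfolding Aq by simp
    qed
    show "((\<lambda>r. - ((A * g) powr (p - 1)) * r powr E) has_real_derivative
        - (-1) * r powr (N + \<sigma> - 1) * wstar N p q \<sigma> r powr q) (at r)"
      unfolding e2 by (intro DERIV_cmult has_real_derivative_powr r)
  qed
qed

section \<open>Comparison and behaviour at infinity\<close>

text \<open>The substitution \<open>x \<mapsto> 1/x\<close> carries the rule at \<open>0\<close> from the right over to infinity.\<close>

lemma lhopital_at_top_0_0:
  fixes f g :: "real \<Rightarrow> real"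
  assumes f: "(f \<longlongrightarrow> 0) at_top" and g: "(g \<longlongrightarrow> 0) at_top"
    and "\<forall>\<^sub>F x in at_top. g x \<noteq> 0" "\<forall>\<^sub>F x in at_top. g' x \<noteq> 0"
    and "\<forall>\<^sub>F x in at_top. (f has_real_derivative f' x) (at x)"
    and "\<forall>\<^sub>F x in at_top. (g has_real_derivative g' x) (at x)"
    and lim: "((\<lambda>x. f' x / g' x) \<longlongrightarrow> l) at_top"
  shows "((\<lambda>x. f x / g x) \<longlongrightarrow> l) at_top"
proof -
  have chain: "((\<lambda>x. h (inverse x)) has_real_derivative h' (inverse x) * - (inverse x ^ Suc (Suc 0))) (at x)"
    if "(h has_real_derivative h' (inverse x)) (at (inverse x))" "x > 0" for h h' :: "real \<Rightarrow> real" and x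
    using that by (intro DERIV_chain2[of h _ inverse] DERIV_inverse) auto
  note pos = eventually_at_right_less[of "0 :: real"]
  have "((\<lambda>x. f (inverse x) / g (inverse x)) \<longlongrightarrow> l) (at_right 0)"
  proof (rule lhopital_right_0[where f' = "\<lambda>x. f' (inverse x) * - (inverse x ^ Suc (Suc 0))"
        and g' = "\<lambda>x. g' (inverse x) * - (inverse x ^ Suc (Suc 0))"])
    show "((\<lambda>x. f (inverse x)) \<longlongrightarrow> 0) (at_right 0)" "((\<lambda>x. g (inverse x)) \<longlongrightarrow> 0) (at_right 0)"
      using f g by (simp_all add: filterlim_at_top_to_right)
    show "\<forall>\<^sub>F x in at_right 0. g (inverse x) \<noteq> 0"
      using assms(3) by (simp add: eventually_at_top_to_right)
    show "\<forall>\<^sub>F x in at_right 0. g' (inverse x) * - (inverse x ^ Suc (Suc 0)) \<noteq> 0"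
      using assms(4) pos unfolding eventually_at_top_to_right by eventually_elim auto
    show "\<forall>\<^sub>F x in at_right 0. ((\<lambda>x. f (inverse x)) has_real_derivative
        f' (inverse x) * - (inverse x ^ Suc (Suc 0))) (at x)"
      using assms(5) pos unfolding eventually_at_top_to_right by eventually_elim (rule chain)
    show "\<forall>\<^sub>F x in at_right 0. ((\<lambda>x. g (inverse x)) has_real_derivative
        g' (inverse x) * - (inverse x ^ Suc (Suc 0))) (at x)"
      using assms(6) pos unfolding eventually_at_top_to_right by eventually_elim (rule chain)
    have "((\<lambda>x. f' (inverse x) / g' (inverse x)) \<longlongrightarrow> l) (at_right 0)"
      using lim by (simp add: filterlim_at_top_to_right)
    then show "((\<lambda>x. f' (inverse x) * - (inverse x ^ Suc (Suc 0)) /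
        (g' (inverse x) * - (inverse x ^ Suc (Suc 0)))) \<longlongrightarrow> l) (at_right 0)"
      by (rule Lim_transform_eventually) (use pos in eventually_elim, auto)
  qed
  then show ?thesis by (simp add: filterlim_at_top_to_right)
qed

lemma powr_neg_tendsto_0: "e < 0 \<Longrightarrow> ((\<lambda>r :: real. r powr e) \<longlongrightarrow> 0) at_top"
  by (rule tendsto_neg_powr[OF _ filterlim_ident])

text \<open>The absorption term is increasing in \<open>w\<close>. At a positive maximum of \<open>w1 - w2\<close> the derivatives, and hence the
fluxes, agree; just to the right the flux difference increases because \<open>w1 > w2\<close>, so \<open>w1 - w2\<close> increases too, which
contradicts maximality. Orderings at both ends are only needed up to an arbitrary \<open>e > 0\<close>.\<close>

lemma comparison_principle:
  assumes p: "p > 1" and q: "q > 0"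
    and sol1: "first_order_solution N p q \<sigma> (-1) {0<..} w1 u1"
    and sol2: "first_order_solution N p q \<sigma> (-1) {0<..} w2 u2"
    and at0: "\<And>e. e > 0 \<Longrightarrow> \<forall>\<^sub>F r in at_right 0. w1 r < w2 r + e"
    and atinf: "\<And>e. e > 0 \<Longrightarrow> \<forall>\<^sub>F r in at_top. w1 r < w2 r + e"
    and x0: "x0 > 0"
  shows "w1 x0 \<le> w2 x0"
proof (rule ccontr)
  assume neg: "\<not> w1 x0 \<le> w2 x0"
  define k where "k r = r powr (- ((N - 1) / (p - 1)))" for r
  define d where "d r = w1 r - w2 r" for r
  define d' where "d' r = k r * (signed_powr (1 / (p - 1)) (u1 r) - signed_powr (1 / (p - 1)) (u2 r))" for r
  have e: "d x0 > 0" using neg by (simp add: d_def)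
  have w: "w1 r > 0" "w2 r > 0" if "r > 0" for r
    using sol1 sol2 that unfolding first_order_solution_def by auto
  have D1: "(w1 has_real_derivative k r * signed_powr (1 / (p - 1)) (u1 r)) (at r)"
      "(u1 has_real_derivative r powr (N + \<sigma> - 1) * w1 r powr q) (at r)" if "r > 0" for r
    using sol1 that unfolding first_order_solution_def k_def by auto
  have D2: "(w2 has_real_derivative k r * signed_powr (1 / (p - 1)) (u2 r)) (at r)"
      "(u2 has_real_derivative r powr (N + \<sigma> - 1) * w2 r powr q) (at r)" if "r > 0" for r
    using sol2 that unfolding first_order_solution_def k_def by auto
  have Dd: "(d has_real_derivative d' r) (at r)" if "r > 0" for r
    using DERIV_diff[OF D1(1) D2(1), OF that that] unfolding d_def[abs_def] d'_def right_diff_distrib .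
  have Du: "((\<lambda>r. u1 r - u2 r) has_real_derivative
      r powr (N + \<sigma> - 1) * (w1 r powr q - w2 r powr q)) (at r)" if "r > 0" for r
    using DERIV_diff[OF D1(2) D2(2), OF that that] unfolding right_diff_distrib .
  obtain \<alpha>0 where \<alpha>0: "\<alpha>0 > 0" "\<And>r. 0 < r \<Longrightarrow> r < \<alpha>0 \<Longrightarrow> d r < d x0"
  proof -
    have "\<forall>\<^sub>F r in at_right 0. d r < d x0"
      using at0[OF e] by eventually_elim (simp add: d_def)
    then show ?thesis using that unfolding eventually_at_right_field by blast
  qed
  define \<alpha> where "\<alpha> = min x0 \<alpha>0 / 2"
  have \<alpha>: "\<alpha> > 0" "\<alpha> < x0" "d \<alpha> < d x0" using \<alpha>0 x0 by (auto simp: \<alpha>_def)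
  obtain \<beta>0 where \<beta>0: "\<And>r. r \<ge> \<beta>0 \<Longrightarrow> d r < d x0"
  proof -
    have "\<forall>\<^sub>F r in at_top. d r < d x0"
      using atinf[OF e] by eventually_elim (simp add: d_def)
    then show ?thesis using that unfolding eventually_at_top_linorder by blast
  qed
  define \<beta> where "\<beta> = max (x0 + 1) \<beta>0"
  have \<beta>: "\<beta> > x0" "d \<beta> < d x0" using \<beta>0 by (auto simp: \<beta>_def)
  have cont: "continuous_on {s..t} d" if "s > 0" for s t
    by (rule DERIV_continuous_on, rule has_field_derivative_at_within, rule Dd) (use that in auto)
  obtain m where m: "m \<in> {\<alpha>..\<beta>}" "\<And>y. y \<in> {\<alpha>..\<beta>} \<Longrightarrow> d y \<le> d m"
    using continuous_attains_sup[of "{\<alpha>..\<beta>}" d] cont \<alpha> \<beta> by fastforce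
  have dm: "d m \<ge> d x0" using m(2)[of x0] \<alpha> \<beta> by auto
  have m_int: "\<alpha> < m" "m < \<beta>" "m > 0"
    using m(1) dm \<alpha> \<beta> by (auto simp: less_eq_real_def)
  have "d' m = 0"
  proof (rule DERIV_local_max[OF Dd[OF m_int(3)]])
    show "min (m - \<alpha>) (\<beta> - m) > 0" using m_int by auto
    show "\<forall>y. \<bar>m - y\<bar> < min (m - \<alpha>) (\<beta> - m) \<longrightarrow> d y \<le> d m" by (auto intro!: m(2))
  qed
  then have "signed_powr (1 / (p - 1)) (u1 m) = signed_powr (1 / (p - 1)) (u2 m)"
    using m_int by (simp add: d'_def k_def)
  then have um: "u1 m = u2 m"
    using signed_powr_less[of "1 / (p - 1)" "u1 m" "u2 m"] signed_powr_less[of "1 / (p - 1)" "u2 m" "u1 m"] p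
    by (cases "u1 m" "u2 m" rule: linorder_cases) auto
  have "isCont d m" using Dd[OF m_int(3)] by (rule DERIV_isCont)
  then have "\<forall>\<^sub>F y in at m. d y > 0" 
    using order_tendstoD(1)[of d "d m" "at m" 0] dm e unfolding isCont_def by linarith
  then obtain \<delta>0 where \<delta>0: "\<delta>0 > 0" "\<And>y. y \<noteq> m \<Longrightarrow> \<bar>y - m\<bar> < \<delta>0 \<Longrightarrow> d y > 0"
    unfolding eventually_at dist_real_def by blast
  define t where "t = m + min \<delta>0 (\<beta> - m) / 2"
  have t: "m < t" "t < \<beta>" "t - m < \<delta>0" using \<delta>0 m_int by (auto simp: t_def min_def field_simps)
  have dpos: "d y > 0" if "m < y" "y \<le> t" for y using \<delta>0(2)[of y] that t by auto
  have upos: "u1 y > u2 y" if "m < y" "y < t" for y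
  proof -
    have "u1 m - u2 m < u1 y - u2 y"
    proof (rule DERIV_pos_imp_increasing_open[OF that(1)])
      fix x assume x: "m < x" "x < y"
      then have x0: "x > 0" using m_int by simp
      have "w2 x powr q < w1 x powr q"
        using dpos[of x] x that w[OF x0] q by (intro powr_less_mono2) (auto simp: d_def)
      then have "x powr (N + \<sigma> - 1) * (w1 x powr q - w2 x powr q) > 0" using x0 by simp
      with Du[OF x0] show "\<exists>y. ((\<lambda>r. u1 r - u2 r) has_real_derivative y) (at x) \<and> 0 < y" by blast
    next
      show "continuous_on {m..y} (\<lambda>r. u1 r - u2 r)"
        by (rule DERIV_continuous_on, rule has_field_derivative_at_within, rule Du) (use m_int in auto)
    qed
    then show ?thesis using um by simp
  qed
  have "d m < d t"
  proof (rule DERIV_pos_imp_increasing_open[OF t(1)])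
    fix x assume x: "m < x" "x < t"
    then have x0: "x > 0" using m_int by simp
    have "signed_powr (1 / (p - 1)) (u2 x) < signed_powr (1 / (p - 1)) (u1 x)" using upos[OF x] p by (intro signed_powr_less) auto
    then have "d' x > 0" using x0 by (simp add: d'_def k_def)
    with Dd[OF x0] show "\<exists>y. (d has_real_derivative y) (at x) \<and> 0 < y" by blast
  qed (use cont m_int in auto)
  moreover have "d t \<le> d m" using m(2)[of t] t m_int by auto
  ultimately show False by simp
qed

lemma first_order_scaling:
  assumes "q > p - 1" "p > 1" and \<mu>: "\<mu> > 0"
    and sol: "first_order_solution N p q \<sigma> (-1) {0<..} w u"
  defines "g \<equiv> gam p q \<sigma>"
  shows "first_order_solution N p q \<sigma> (-1) {0<..} (\<lambda>r. \<mu> powr g * w (\<mu> * r))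
     (\<lambda>r. \<mu> powr ((g + 1) * (p - 1) - (N - 1)) * u (\<mu> * r))"
  unfolding first_order_solution_def
proof (intro ballI conjI)
  fix r :: real assume "r \<in> {0<..}"
  then have r: "r > 0" and lr: "\<mu> * r > 0" using \<mu> by auto
  define e where "e = (g + 1) * (p - 1) - (N - 1)"
  have gq: "g * (q - p + 1) = p + \<sigma>" using assms unfolding g_def gam_def by (simp add: field_simps)
  have s: "w (\<mu> * r) > 0"
      "(w has_real_derivative (\<mu> * r) powr (- ((N - 1) / (p - 1))) * signed_powr (1 / (p - 1)) (u (\<mu> * r))) (at (\<mu> * r))"
      "(u has_real_derivative (\<mu> * r) powr (N + \<sigma> - 1) * w (\<mu> * r) powr q) (at (\<mu> * r))"
    using sol lr unfolding first_order_solution_def by auto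
  have lin: "((\<lambda>r. \<mu> * r) has_real_derivative \<mu>) (at r)"
    using DERIV_cmult_Id[of \<mu> r] by (simp add: DERIV_cmult_Id)
  show "\<mu> powr g * w (\<mu> * r) > 0" using s \<mu> by simp
  have e1: "\<mu> powr g * ((\<mu> * r) powr (- ((N - 1) / (p - 1))) * signed_powr (1 / (p - 1)) (u (\<mu> * r)) * \<mu>)
     = r powr (- ((N - 1) / (p - 1))) * signed_powr (1 / (p - 1)) (\<mu> powr e * u (\<mu> * r))"
  proof -
    have "e / (p - 1) = g + - ((N - 1) / (p - 1)) + 1" using assms unfolding e_def by (simp add: field_simps)
    then have "\<mu> powr (e / (p - 1)) = \<mu> powr g * \<mu> powr (- ((N - 1) / (p - 1))) * \<mu>"
      using \<mu> by (simp only: powr_add) simp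
    then show ?thesis using \<mu> r by (simp add: signed_powr_mult powr_mult powr_powr)
  qed
  show "((\<lambda>r. \<mu> powr g * w (\<mu> * r)) has_real_derivative
      r powr (- ((N - 1) / (p - 1))) * signed_powr (1 / (p - 1)) (\<mu> powr e * u (\<mu> * r))) (at r)"
    unfolding e1[symmetric] by (intro DERIV_cmult DERIV_chain2[of w _ "\<lambda>r. \<mu> * r"] s(2) lin)
  have e2: "\<mu> powr e * ((\<mu> * r) powr (N + \<sigma> - 1) * w (\<mu> * r) powr q * \<mu>)
     = - (-1) * r powr (N + \<sigma> - 1) * (\<mu> powr g * w (\<mu> * r)) powr q"
  proof -
    have "g * q = e + (N + \<sigma> - 1) + 1" using gq unfolding e_def by (simp add: algebra_simps)
    then have "\<mu> powr (g * q) = \<mu> powr e * \<mu> powr (N + \<sigma> - 1) * \<mu>"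
      using \<mu> by (simp only: powr_add) simp
    then show ?thesis using \<mu> r s(1) by (simp add: powr_mult powr_powr)
  qed
  show "((\<lambda>r. \<mu> powr e * u (\<mu> * r)) has_real_derivative
      - (-1) * r powr (N + \<sigma> - 1) * (\<mu> powr g * w (\<mu> * r)) powr q) (at r)"
    unfolding e2[symmetric] by (intro DERIV_cmult DERIV_chain2[of u _ "\<lambda>r. \<mu> * r"] s(3) lin)
qed

lemma flux_increasing:
  assumes sol: "first_order_solution N p q \<sigma> (-1) {0<..} w u" and "0 < s" "s \<le> t"
  shows "u s \<le> u t"
proof (rule DERIV_nonneg_imp_nondecreasing[OF assms(3)])
  fix x assume "s \<le> x" "x \<le> t"
  then have "x > 0" using assms by simp
  then have "(u has_real_derivative x powr (N + \<sigma> - 1) * w x powr q) (at x)"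
    using sol unfolding first_order_solution_def by auto
  then show "\<exists>y. (u has_real_derivative y) (at x) \<and> 0 \<le> y" by (intro exI conjI) auto
qed

text \<open>A flux bounded away from \<open>0\<close> would push \<open>w\<close> below zero, and a profile bounded away from \<open>0\<close> would push the flux
above zero; both quantities are monotone, so both tend to \<open>0\<close>.\<close>

lemma decreasing_solution_decays:
  assumes p: "p > 1" "p > N" "N > - \<sigma>" and q: "q > 0"
    and sol: "first_order_solution N p q \<sigma> (-1) {0<..} w u" and neg: "\<And>r. r > 0 \<Longrightarrow> u r \<le> 0"
  shows "(u \<longlongrightarrow> 0) at_top" and "(w \<longlongrightarrow> 0) at_top"
proof -
  have w: "w r > 0" and Dw: "(w has_real_derivative r powr (- ((N - 1) / (p - 1))) * signed_powr (1 / (p - 1)) (u r)) (at r)"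
    and Du: "(u has_real_derivative r powr (N + \<sigma> - 1) * w r powr q) (at r)" if "r > 0" for r
    using sol that unfolding first_order_solution_def by auto
  show "(u \<longlongrightarrow> 0) at_top"
  proof (rule tendstoI)
    fix e :: real assume e: "e > 0"
    have "\<exists>r>0. u r > - e"
    proof (rule ccontr)
      assume "\<not> (\<exists>r>0. u r > - e)"
      then show False
        using flux_not_uniformly_negative[OF p(1,2) order_refl sol e] by force
    qed
    then obtain r where r: "r > 0" "u r > - e" by blast
    show "\<forall>\<^sub>F x in at_top. dist (u x) 0 < e"
      using eventually_ge_at_top[of r]
    proof eventually_elim
      case (elim x)
      then show ?case using flux_increasing[OF sol r(1) elim] neg[of x] r e by auto
    qed
  qed
  have w_mono: "w t \<le> w s" if "0 < s" "s \<le> t" for s t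
  proof (rule DERIV_nonpos_imp_nonincreasing[OF that(2)])
    fix x assume "s \<le> x" "x \<le> t"
    then have x: "x > 0" using that by simp
    have "signed_powr (1 / (p - 1)) (u x) \<le> 0" using neg[OF x] by (simp add: signed_powr_def mult_le_0_iff)
    then have "x powr (- ((N - 1) / (p - 1))) * signed_powr (1 / (p - 1)) (u x) \<le> 0" by (simp add: mult_le_0_iff)
    with Dw[OF x] show "\<exists>y. (w has_real_derivative y) (at x) \<and> y \<le> 0" by blast
  qed
  show "(w \<longlongrightarrow> 0) at_top"
  proof (rule tendstoI)
    fix e :: real assume e: "e > 0"
    have "\<exists>r>0. w r < e"
    proof (rule ccontr)
      assume "\<not> (\<exists>r>0. w r < e)"
      then have ge: "w r \<ge> e" if "r > 0" for r using that by force
      have "filterlim u at_top at_top"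
      proof (rule power_growth_unbounded[of "e powr q" "N + \<sigma>" 0])
        fix r :: real assume r: "r > 0"
        show "(u has_real_derivative r powr (N + \<sigma> - 1) * w r powr q) (at r)" by (rule Du[OF r])
        have "e powr q \<le> w r powr q" using ge[OF r] e q by (intro powr_mono2) auto
        then show "r powr (N + \<sigma> - 1) * w r powr q \<ge> e powr q * r powr (N + \<sigma> - 1)"
          using mult_left_mono[of _ _ "r powr (N + \<sigma> - 1)"] by (simp add: mult.commute)
      qed (use e p in auto)
      then have "\<forall>\<^sub>F r in at_top. u r \<ge> 1" unfolding filterlim_at_top by blast
      moreover have "\<forall>\<^sub>F r in at_top. u r \<le> 0"
        using eventually_gt_at_top[of 0] by eventually_elim (rule neg)
      ultimately have "\<forall>\<^sub>F r in at_top :: real filter. False" by eventually_elim auto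
      then show False by simp
    qed
    then obtain r where r: "r > 0" "w r < e" by blast
    show "\<forall>\<^sub>F x in at_top. dist (w x) 0 < e"
      using eventually_ge_at_top[of r]
    proof eventually_elim
      case (elim x)
      then show ?case using w_mono[OF r(1) elim] w[of x] r by auto
    qed
  qed
qed

text \<open>Let \<open>z = r\<^bsup>\<gamma>\<^esup> w\<close>. Comparison with \<open>w*\<close> bounds \<open>z\<close>. Comparison with the rescaled solution
\<open>\<mu>\<^bsup>\<gamma>\<^esup> w(\<mu> r)\<close>, \<open>\<mu> \<ge> 1\<close>, whose value \<open>\<mu>\<^bsup>\<gamma>\<^esup> w\<^sub>0\<close> at \<open>0\<close> is not smaller, shows that \<open>z\<close> is nondecreasing. So \<open>z\<close> has
a limit \<open>L > 0\<close>. L'Hopital's rule turns it into the limit of \<open>u / r\<^bsup>E\<^esup>\<close> and this back into the limit of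
\<open>w / r\<^bsup>-\<gamma>\<^esup>\<close>; the resulting equation \<open>(\<gamma> L)\<^bsup>p-1\<^esup> = L\<^bsup>q\<^esup> / (- E)\<close> determines \<open>L = a*\<close>.\<close>

theorem decreasing_solution_asymptotic:
  assumes q: "q > p - 1" and p: "p > 1" "p > N" "N > - \<sigma>"
    and sol: "first_order_solution N p q \<sigma> (-1) {0<..} w u" and neg: "\<And>r. r > 0 \<Longrightarrow> u r \<le> 0"
    and w0: "w0 > 0" "(w \<longlongrightarrow> w0) (at_right 0)"
  shows "w \<sim>[at_top] wstar N p q \<sigma>"
proof -
  define g where "g = gam p q \<sigma>"
  define A where "A = astar N p q \<sigma>"
  define E where "E = N - p - g * (p - 1)"
  define z where "z r = r powr g * w r" for r
  have q0: "q > 0" using q p by simp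
  have g: "g > 0" unfolding g_def using q p by (intro gam_pos) auto
  have gq: "g * (q - p + 1) = p + \<sigma>" using q unfolding g_def gam_def by (simp add: field_simps)
  have E: "E < 0" using mult_pos_pos[of g "p - 1"] g p unfolding E_def by linarith
  have A: "A = (g powr (p - 1) * (- E)) powr (1 / (q - p + 1))"
    unfolding A_def g_def E_def using astar_eq[OF q p] by (simp add: algebra_simps)
  have Apos: "A > 0" using A g E by (simp add: zero_less_mult_iff)
  have ws: "wstar N p q \<sigma> r = A * r powr (- g)" for r
    unfolding wstar_def A_def g_def gam_def ..
  have w: "w r > 0" and Dw: "(w has_real_derivative r powr (- ((N - 1) / (p - 1))) * signed_powr (1 / (p - 1)) (u r)) (at r)"
    and Du: "(u has_real_derivative r powr (N + \<sigma> - 1) * w r powr q) (at r)" if "r > 0" for r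
    using sol that unfolding first_order_solution_def by auto
  note decay = decreasing_solution_decays[OF p q0 sol neg]
  have upper: "w r \<le> A * r powr (- g)" if "r > 0" for r
  proof -
    have ws_inf: "filterlim (wstar N p q \<sigma>) at_top (at_right 0)"
    proof -
      have "filterlim (\<lambda>r :: real. r powr (- g)) at_top (at_right 0)"
      proof (rule filterlim_at_top_mono)
        show "filterlim (\<lambda>r. exp (g * (- ln r))) at_top (at_right 0)"
          using g by (intro filterlim_compose[OF exp_at_top] filterlim_tendsto_pos_mult_at_top[OF tendsto_const]
              filterlim_uminus_at_bot[THEN iffD1] ln_at_0) 
        show "\<forall>\<^sub>F r in at_right 0. exp (g * (- ln r)) \<le> r powr (- g)"
          using eventually_at_right_less[of "0 :: real"] by eventually_elim (simp add: powr_def)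
      qed
      then show ?thesis unfolding ws[abs_def]
        using Apos by (intro filterlim_tendsto_pos_mult_at_top[OF tendsto_const]) auto
    qed
    have "w r \<le> wstar N p q \<sigma> r"
    proof (rule comparison_principle[OF p(1) q0 sol wstar_first_order[OF q p] _ _ that])
      fix e :: real assume e: "e > 0"
      have "\<forall>\<^sub>F r in at_right 0. w r < w0 + e" using order_tendstoD(2)[OF w0(2), of "w0 + e"] e by simp
      moreover have "\<forall>\<^sub>F r in at_right 0. wstar N p q \<sigma> r \<ge> w0" using ws_inf unfolding filterlim_at_top by blast
      ultimately show "\<forall>\<^sub>F r in at_right 0. w r < wstar N p q \<sigma> r + e" by eventually_elim auto
      have "\<forall>\<^sub>F r in at_top. w r < e" using order_tendstoD(2)[OF decay(2) e] .
      then show "\<forall>\<^sub>F r in at_top. w r < wstar N p q \<sigma> r + e"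
      proof eventually_elim
        case (elim r)
        have "wstar N p q \<sigma> r \<ge> 0" using Apos by (simp add: ws)
        with elim show ?case by linarith
      qed
    qed
    then show ?thesis by (simp add: ws)
  qed
  have z_bound: "z r \<le> A" "z r > 0" if "r > 0" for r
  proof -
    have "z r \<le> r powr g * (A * r powr (- g))" unfolding z_def by (intro mult_left_mono upper that) auto
    also have "\<dots> = A" using that by (simp add: powr_minus)
    finally show "z r \<le> A" .
    show "z r > 0" using w[OF that] that by (simp add: z_def)
  qed
  have z_mono: "z s \<le> z t" if st: "0 < s" "s \<le> t" for s t
  proof -
    define \<mu> where "\<mu> = t / s"
    have \<mu>: "\<mu> \<ge> 1" "\<mu> > 0" using st by (auto simp: \<mu>_def)
    have \<mu>g: "\<mu> powr g \<ge> 1" using \<mu> g by (simp add: ge_one_powr_ge_zero)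
    have scale0: "filterlim (\<lambda>r. \<mu> * r) (at_right 0) (at_right 0)"
      unfolding filterlim_at
    proof
      show "\<forall>\<^sub>F r in at_right 0. \<mu> * r \<in> {0<..} \<and> \<mu> * r \<noteq> 0"
        using eventually_at_right_less[of "0 :: real"] by eventually_elim (use \<mu> in auto)
      have "((\<lambda>r. \<mu> * r) \<longlongrightarrow> \<mu> * 0) (at_right 0)" by (intro tendsto_intros)
      then show "((\<lambda>r. \<mu> * r) \<longlongrightarrow> 0) (at_right 0)" by simp
    qed
    have "w s \<le> \<mu> powr g * w (\<mu> * s)"
    proof (rule comparison_principle[OF p(1) q0 sol first_order_scaling[OF q p(1) \<mu>(2) sol, folded g_def] _ _ st(1)])
      fix e :: real assume e: "e > 0"
      have "((\<lambda>r. \<mu> powr g * w (\<mu> * r) + e - w r) \<longlongrightarrow> \<mu> powr g * w0 + e - w0) (at_right 0)"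
        by (intro tendsto_intros filterlim_compose[OF w0(2) scale0] w0(2))
      moreover have "\<mu> powr g * w0 + e - w0 > 0"
        using mult_right_mono[OF \<mu>g, of w0] w0 e by linarith
      ultimately have "\<forall>\<^sub>F r in at_right 0. \<mu> powr g * w (\<mu> * r) + e - w r > 0" by (rule order_tendstoD(1))
      then show "\<forall>\<^sub>F r in at_right 0. w r < \<mu> powr g * w (\<mu> * r) + e" by eventually_elim auto
      have "\<forall>\<^sub>F r in at_top. w r < e" using order_tendstoD(2)[OF decay(2) e] .
      then show "\<forall>\<^sub>F r in at_top. w r < \<mu> powr g * w (\<mu> * r) + e"
        using eventually_gt_at_top[of 0]
      proof eventually_elim
        case (elim r)
        then have "\<mu> powr g * w (\<mu> * r) \<ge> 0" using w[of "\<mu> * r"] \<mu> by simp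
        then show ?case using elim by linarith
      qed
    qed
    then have "z s \<le> s powr g * (\<mu> powr g * w (\<mu> * s))" unfolding z_def by (intro mult_left_mono) auto
    also have "\<dots> = z t" using st \<mu> by (simp add: z_def \<mu>_def powr_divide)
    finally show ?thesis .
  qed
  define L where "L = Sup (z ` {0<..})"
  have bdd: "bdd_above (z ` {0<..})" by (intro bdd_aboveI[of _ A]) (auto intro: z_bound)
  have zL: "z r \<le> L" if "r > 0" for r unfolding L_def using that bdd by (intro cSup_upper) auto
  have Lpos: "L > 0" using zL[of 1] z_bound(2)[of 1] by simp
  have lim: "(z \<longlongrightarrow> L) at_top"
  proof (rule order_tendstoI)
    fix y assume "y < L"
    then obtain r where r: "r > 0" "z r > y" unfolding L_def using less_cSup_iff[OF _ bdd] by auto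
    show "\<forall>\<^sub>F x in at_top. y < z x"
      using eventually_ge_at_top[of r] by eventually_elim (rule less_le_trans[OF r(2) z_mono[OF r(1)]])
  next
    fix y assume y: "L < y"
    show "\<forall>\<^sub>F x in at_top. z x < y"
      using eventually_gt_at_top[of 0] by eventually_elim (rule le_less_trans[OF zL y])
  qed
  have flux_lim: "((\<lambda>r. u r / r powr E) \<longlongrightarrow> L powr q / E) at_top"
  proof (rule lhopital_at_top_0_0[where f' = "\<lambda>r. r powr (N + \<sigma> - 1) * w r powr q" and g' = "\<lambda>r. E * r powr (E - 1)"])
    show "(u \<longlongrightarrow> 0) at_top" by (rule decay(1))
    show "((\<lambda>r. r powr E) \<longlongrightarrow> 0) at_top" by (rule powr_neg_tendsto_0[OF E])
    note ev = eventually_gt_at_top[of "0 :: real"]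
    show "\<forall>\<^sub>F r :: real in at_top. r powr E \<noteq> 0" using ev by eventually_elim auto
    show "\<forall>\<^sub>F r in at_top. E * r powr (E - 1) \<noteq> 0" using ev by eventually_elim (use E in auto)
    show "\<forall>\<^sub>F r in at_top. (u has_real_derivative r powr (N + \<sigma> - 1) * w r powr q) (at r)"
      using ev by eventually_elim (rule Du)
    show "\<forall>\<^sub>F r in at_top. ((\<lambda>r. r powr E) has_real_derivative E * r powr (E - 1)) (at r)"
      using ev by eventually_elim (rule has_real_derivative_powr)
    have "((\<lambda>r. z r powr q / E) \<longlongrightarrow> L powr q / E) at_top"
      using E Lpos by (intro tendsto_intros lim) auto
    then show "((\<lambda>r. r powr (N + \<sigma> - 1) * w r powr q / (E * r powr (E - 1))) \<longlongrightarrow> L powr q / E) at_top"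
    proof (rule Lim_transform_eventually)
      show "\<forall>\<^sub>F r in at_top. z r powr q / E = r powr (N + \<sigma> - 1) * w r powr q / (E * r powr (E - 1))"
        using ev
      proof eventually_elim
        case (elim r)
        have "N + \<sigma> - 1 = g * q + (E - 1)" using gq unfolding E_def by (simp add: algebra_simps)
        then have "r powr (N + \<sigma> - 1) = r powr (g * q) * r powr (E - 1)" by (simp only: powr_add)
        then show ?case using elim w[OF elim] by (simp add: z_def powr_mult powr_powr)
      qed
    qed
  qed
  define \<kappa> where "\<kappa> = L powr q / (- E)"
  have \<kappa>: "\<kappa> > 0" unfolding \<kappa>_def using Lpos E by (intro divide_pos_pos) auto
  have "((\<lambda>r. w r / r powr (- g)) \<longlongrightarrow> \<kappa> powr (1 / (p - 1)) / g) at_top"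
  proof (rule lhopital_at_top_0_0[where f' = "\<lambda>r. r powr (- ((N - 1) / (p - 1))) * signed_powr (1 / (p - 1)) (u r)"
        and g' = "\<lambda>r. - g * r powr (- g - 1)"])
    show "(w \<longlongrightarrow> 0) at_top" by (rule decay(2))
    show "((\<lambda>r. r powr (- g)) \<longlongrightarrow> 0) at_top" using g by (intro powr_neg_tendsto_0) auto
    note ev = eventually_gt_at_top[of "0 :: real"]
    show "\<forall>\<^sub>F r :: real in at_top. r powr (- g) \<noteq> 0" using ev by eventually_elim auto
    show "\<forall>\<^sub>F r in at_top. - g * r powr (- g - 1) \<noteq> 0" using ev by eventually_elim (use g in auto)
    show "\<forall>\<^sub>F r in at_top. (w has_real_derivative r powr (- ((N - 1) / (p - 1))) * signed_powr (1 / (p - 1)) (u r)) (at r)"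
      using ev by eventually_elim (rule Dw)
    show "\<forall>\<^sub>F r in at_top. ((\<lambda>r. r powr (- g)) has_real_derivative - g * r powr (- g - 1)) (at r)"
      using ev by eventually_elim (rule has_real_derivative_powr)
    have "isCont (signed_powr (1 / (p - 1))) (L powr q / E)"
      using continuous_on_signed_powr[of "1 / (p - 1)"] p by (simp add: continuous_on_eq_continuous_at)
    then have "((\<lambda>r. signed_powr (1 / (p - 1)) (u r / r powr E) / (- g)) \<longlongrightarrow> signed_powr (1 / (p - 1)) (L powr q / E) / (- g)) at_top"
      using g by (intro tendsto_intros isCont_tendsto_compose[OF _ flux_lim]) auto
    moreover have "signed_powr (1 / (p - 1)) (L powr q / E) / (- g) = \<kappa> powr (1 / (p - 1)) / g"
    proof -
      have "L powr q / E = - \<kappa>" unfolding \<kappa>_def by simp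
      then show ?thesis using \<kappa> by (simp add: signed_powr_pos)
    qed
    ultimately have "((\<lambda>r. signed_powr (1 / (p - 1)) (u r / r powr E) / (- g)) \<longlongrightarrow> \<kappa> powr (1 / (p - 1)) / g) at_top"
      by simp
    then show "((\<lambda>r. r powr (- ((N - 1) / (p - 1))) * signed_powr (1 / (p - 1)) (u r) / (- g * r powr (- g - 1)))
        \<longlongrightarrow> \<kappa> powr (1 / (p - 1)) / g) at_top"
    proof (rule Lim_transform_eventually)
      show "\<forall>\<^sub>F r in at_top. signed_powr (1 / (p - 1)) (u r / r powr E) / (- g)
          = r powr (- ((N - 1) / (p - 1))) * signed_powr (1 / (p - 1)) (u r) / (- g * r powr (- g - 1))"
        using ev
      proof eventually_elim
        case (elim r)
        have "signed_powr (1 / (p - 1)) (u r / r powr E) = signed_powr (1 / (p - 1)) (r powr (- E) * u r)"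
          by (simp add: powr_minus divide_inverse mult.commute)
        also have "\<dots> = r powr (- E / (p - 1)) * signed_powr (1 / (p - 1)) (u r)"
          using elim by (subst signed_powr_mult) (auto simp: powr_powr)
        also have "- E / (p - 1) = - ((N - 1) / (p - 1)) - (- g - 1)"
        proof -
          have "- E / (p - 1) = g - (N - p) / (p - 1)" using p by (simp add: E_def field_simps)
          moreover have "(N - p) / (p - 1) = (N - 1) / (p - 1) - 1" using p by (simp add: field_simps)
          ultimately show ?thesis by simp
        qed
        also have "r powr \<dots> = r powr (- ((N - 1) / (p - 1))) / r powr (- g - 1)" by (rule powr_diff)
        finally show ?case by simp
      qed
    qed
  qed
  moreover have "((\<lambda>r. w r / r powr (- g)) \<longlongrightarrow> L) at_top"
    using lim by (simp add: z_def[abs_def] powr_minus divide_inverse mult.commute)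
  ultimately have "L = \<kappa> powr (1 / (p - 1)) / g" using tendsto_unique[OF trivial_limit_at_top_linorder] by blast
  then have "g * L = \<kappa> powr (1 / (p - 1))" using g by simp
  then have "(g * L) powr (p - 1) = \<kappa>" using \<kappa> p by (simp add: powr_powr)
  then have gL: "g powr (p - 1) * L powr (p - 1) = L powr q / (- E)"
    using g Lpos by (simp add: powr_mult \<kappa>_def)
  have "L powr q = L powr (p - 1) * L powr (q - p + 1)" by (simp add: powr_add[symmetric])
  with gL have "g powr (p - 1) * (- E) = L powr (q - p + 1)"
  proof -
    have "L powr (p - 1) * (g powr (p - 1) * (- E)) = L powr (p - 1) * L powr (q - p + 1)"
      using gL E \<open>L powr q = _\<close> by (simp add: field_simps)
    moreover have "L powr (p - 1) \<noteq> 0" using Lpos by simp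
    ultimately show ?thesis using mult_left_cancel by blast
  qed
  then have "L = A" unfolding A using Lpos q by (simp add: powr_powr)
  have "((\<lambda>r. w r / wstar N p q \<sigma> r) \<longlongrightarrow> 1) at_top"
  proof -
    have "((\<lambda>r. z r / A) \<longlongrightarrow> L / A) at_top" using Apos by (intro tendsto_intros lim) auto
    then show ?thesis using Apos \<open>L = A\<close>
      by (simp add: z_def[abs_def] ws powr_minus divide_inverse mult_ac)
  qed
  then show ?thesis by (rule asymp_equivI')
qed

section \<open>The Cauchy problem at the origin\<close>

text \<open>In the variable \<open>x = r\<^bsup>1/m\<^esup>\<close> the weights of the system are \<open>m x\<^bsup>aexp\<^esup>\<close> and \<open>m x\<^bsup>bexp\<^esup>\<close>. The choice of \<open>m\<close>
makes both exponents positive, so the weights extend continuously by \<open>0\<close>. The nonlinearity is cut off outside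
\<open>[0, M]\<close> to be bounded; the cut-off is invisible to solutions with values in \<open>(0, M]\<close>.\<close>

locale emden_parameters =
  fixes N p q \<sigma> \<epsilon> M :: real
  assumes q: "q > p - 1" and p1: "p > 1" and pN: "p > N" and N\<sigma>: "N > - \<sigma>" and M: "M > 0"
begin

definition m :: real where "m = (p - 1) / (p - N) + 1 / (N + \<sigma>)"
definition aexp :: real where "aexp = m * ((p - N) / (p - 1)) - 1"
definition bexp :: real where "bexp = m * (N + \<sigma>) - 1"
definition a :: "real \<Rightarrow> real" where "a x = m * max x 0 powr aexp"
definition b :: "real \<Rightarrow> real" where "b x = m * max x 0 powr bexp"
definition clamp :: "real \<Rightarrow> real" where "clamp y = min (max y 0) M"
definition F :: "real \<Rightarrow> real" where "F y = - \<epsilon> * clamp y powr q"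

lemma q_pos: "q > 0" using q p1 by simp

lemma m_pos: "m > 0"
proof -
  have "N + \<sigma> > 0" using N\<sigma> by simp
  then have "1 / (N + \<sigma>) > 0" "(p - 1) / (p - N) > 0" using p1 pN by auto
  then show ?thesis unfolding m_def by (rule add_pos_pos[rotated])
qed

lemma exps_pos: "aexp > 0" "bexp > 0"
proof -
  have "m * ((p - N) / (p - 1)) = 1 + 1 / (N + \<sigma>) * ((p - N) / (p - 1))"
    using p1 pN unfolding m_def distrib_right by simp
  moreover have "1 / (N + \<sigma>) * ((p - N) / (p - 1)) > 0" using p1 pN N\<sigma> by simp
  ultimately show "aexp > 0" unfolding aexp_def by linarith
  have "m * (N + \<sigma>) = 1 + (p - 1) / (p - N) * (N + \<sigma>)"
    using N\<sigma> unfolding m_def distrib_right by simp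
  moreover have "(p - 1) / (p - N) * (N + \<sigma>) > 0" using p1 pN N\<sigma> by simp
  ultimately show "bexp > 0" unfolding bexp_def by linarith
qed

lemma clamp_bounds: "0 \<le> clamp y" "clamp y \<le> M"
  using M by (auto simp: clamp_def)

lemma clamp_id: "0 \<le> y \<Longrightarrow> y \<le> M \<Longrightarrow> clamp y = y"
  by (simp add: clamp_def)

lemma clamp_nonpos: "y \<le> 0 \<Longrightarrow> clamp y = 0"
  using M by (simp add: clamp_def)

sublocale weighted_system a b F "signed_powr (1 / (p - 1))" "\<bar>\<epsilon>\<bar> * M powr q"
proof
  show "continuous_on UNIV a" unfolding a_def
    using exps_pos by (intro continuous_intros continuous_on_powr') auto
  show "continuous_on UNIV b" unfolding b_def
    using exps_pos by (intro continuous_intros continuous_on_powr') auto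
  show "continuous_on UNIV F" unfolding F_def clamp_def
    using q_pos M by (intro continuous_intros continuous_on_powr') auto
  show "continuous_on UNIV (signed_powr (1 / (p - 1)))" using p1 by (intro continuous_on_signed_powr) auto
  show "\<bar>F y\<bar> \<le> \<bar>\<epsilon>\<bar> * M powr q" for y
    unfolding F_def using q_pos clamp_bounds[of y]
    by (auto simp: abs_mult intro!: mult_left_mono powr_mono2)
qed

lemma a_pos: "x > 0 \<Longrightarrow> a x > 0" and b_pos: "x > 0 \<Longrightarrow> b x > 0"
  unfolding a_def b_def using m_pos by auto

lemma a_nonneg: "a x \<ge> 0" and b_nonneg: "b x \<ge> 0"
  unfolding a_def b_def using m_pos by auto

context
  fixes W :: "real \<Rightarrow> real" and w0 c :: real
  assumes cont_W: "continuous_on UNIV W" and fixed: "W = profile_of w0 (flux_of c W)"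
begin

lemma W_0: "W 0 = w0"
  by (subst fixed) simp

lemma deriv_W: "x > 0 \<Longrightarrow> (W has_real_derivative a x * signed_powr (1 / (p - 1)) (flux_of c W x)) (at x)"
  by (subst (1) fixed) (rule deriv_profile_of[OF cont_flux_of[OF cont_W]])

lemma radial_deriv_solution:
  assumes r: "r > 0"
  shows "((\<lambda>r. W (r powr (1 / m))) has_real_derivative
     r powr (- ((N - 1) / (p - 1))) * signed_powr (1 / (p - 1)) (flux_of c W (r powr (1 / m)))) (at r)"
proof -
  have x: "r powr (1 / m) > 0" using r by simp
  have D: "((\<lambda>r. r powr (1 / m)) has_real_derivative (1 / m) * r powr (1 / m - 1)) (at r)"
    by (rule has_real_derivative_powr[OF r])
  have ex: "aexp / m + (1 / m - 1) = - ((N - 1) / (p - 1))"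
  proof -
    have "aexp / m + (1 / m - 1) = (p - N) / (p - 1) - 1"
    proof -
      define d where "d = (p - N) / (p - 1)"
      have "(m * d - 1) / m = d - 1 / m" using m_pos by (simp add: diff_divide_distrib)
      then show ?thesis unfolding aexp_def d_def[symmetric] by simp
    qed
    also have "\<dots> = - ((N - 1) / (p - 1))" using p1 by (simp add: field_simps)
    finally show ?thesis .
  qed
  have "a (r powr (1 / m)) * ((1 / m) * r powr (1 / m - 1)) = r powr (aexp / m) * r powr (1 / m - 1)"
    using m_pos r by (simp add: a_def powr_powr)
  also have "\<dots> = r powr (- ((N - 1) / (p - 1)))" unfolding ex[symmetric] powr_add ..
  finally have eq: "a (r powr (1 / m)) * ((1 / m) * r powr (1 / m - 1)) = r powr (- ((N - 1) / (p - 1)))" .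
  have swap: "x * y * z = x * z * y" for x y z :: real by simp
  show ?thesis
    using DERIV_chain2[OF deriv_W[OF x] D]
    unfolding swap[of "a _" "signed_powr _ _"] eq .
qed

lemma radial_deriv_flux:
  assumes r: "r > 0"
  shows "((\<lambda>r. flux_of c W (r powr (1 / m))) has_real_derivative
     - \<epsilon> * r powr (N + \<sigma> - 1) * clamp (W (r powr (1 / m))) powr q) (at r)"
proof -
  have x: "r powr (1 / m) > 0" using r by simp
  have D: "((\<lambda>r. r powr (1 / m)) has_real_derivative (1 / m) * r powr (1 / m - 1)) (at r)"
    by (rule has_real_derivative_powr[OF r])
  have ex: "bexp / m + (1 / m - 1) = N + \<sigma> - 1"
    using m_pos by (simp add: bexp_def field_simps)
  have "b (r powr (1 / m)) * ((1 / m) * r powr (1 / m - 1)) = r powr (bexp / m) * r powr (1 / m - 1)"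
    using m_pos r by (simp add: b_def powr_powr)
  also have "\<dots> = r powr (N + \<sigma> - 1)" unfolding ex[symmetric] powr_add ..
  finally have eq: "b (r powr (1 / m)) * ((1 / m) * r powr (1 / m - 1)) = r powr (N + \<sigma> - 1)" .
  have swap: "x * y * z = x * z * y" for x y z :: real by simp
  have "r powr (N + \<sigma> - 1) * F (W (r powr (1 / m)))
      = - \<epsilon> * r powr (N + \<sigma> - 1) * clamp (W (r powr (1 / m))) powr q"
    by (simp add: F_def)
  then show ?thesis
    using DERIV_chain2[OF deriv_flux_of[OF cont_W x] D]
    unfolding swap[of "b _" "F _"] eq by (rule subst)
qed

lemma radial_tendsto_0:
  "((\<lambda>r. W (r powr (1 / m))) \<longlongrightarrow> w0) (at_right 0)"
  "((\<lambda>r. flux_of c W (r powr (1 / m))) \<longlongrightarrow> c) (at_right 0)"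
proof -
  have "((\<lambda>r. r powr (1 / m)) \<longlongrightarrow> 0 powr (1 / m)) (at_right 0)"
    using m_pos eventually_at_right_less[of "0 :: real"]
    by (intro tendsto_powr' tendsto_intros) (auto elim: eventually_mono)
  then have lim: "((\<lambda>r. r powr (1 / m)) \<longlongrightarrow> 0) (at_right 0)" by simp
  have "isCont W 0" "isCont (flux_of c W) 0"
    using cont_W cont_flux_of[OF cont_W] by (auto simp: continuous_on_eq_continuous_at)
  from isCont_tendsto_compose[OF this(1) lim] isCont_tendsto_compose[OF this(2) lim]
  show "((\<lambda>r. W (r powr (1 / m))) \<longlongrightarrow> w0) (at_right 0)"
    "((\<lambda>r. flux_of c W (r powr (1 / m))) \<longlongrightarrow> c) (at_right 0)" by (simp_all add: W_0)
qed

lemma radial_first_order_solution: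
  assumes "I \<subseteq> {0<..}" "\<And>r. r \<in> I \<Longrightarrow> 0 < W (r powr (1 / m)) \<and> W (r powr (1 / m)) \<le> M"
  shows "first_order_solution N p q \<sigma> \<epsilon> I (\<lambda>r. W (r powr (1 / m))) (\<lambda>r. flux_of c W (r powr (1 / m)))"
  unfolding first_order_solution_def
proof (intro ballI conjI)
  fix r assume r: "r \<in> I"
  then have r0: "r > 0" using assms(1) by auto
  show "W (r powr (1 / m)) > 0" using assms(2)[OF r] by simp
  show "((\<lambda>r. W (r powr (1 / m))) has_real_derivative
      r powr (- ((N - 1) / (p - 1))) * signed_powr (1 / (p - 1)) (flux_of c W (r powr (1 / m)))) (at r)"
    by (rule radial_deriv_solution[OF r0])
  have "clamp (W (r powr (1 / m))) = W (r powr (1 / m))" using assms(2)[OF r] by (intro clamp_id) auto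
  then show "((\<lambda>r. flux_of c W (r powr (1 / m))) has_real_derivative
      - \<epsilon> * r powr (N + \<sigma> - 1) * W (r powr (1 / m)) powr q) (at r)"
    using radial_deriv_flux[OF r0] by simp
qed

end

end

text \<open>The free initial values at the origin. The auxiliary function \<open>y\<close> is \<open>w\<close> after the cut-off; it has the same limit, so
the rates at \<open>0\<close> can be computed before positivity of \<open>w\<close> is known. This order matters when \<open>w0 = 0\<close>.\<close>

theorem cauchy_problem_at_0:
  fixes N p q \<sigma> \<epsilon> w0 c :: real
  assumes "q > p - 1" "p > 1" "p > N" "N > - \<sigma>" "w0 \<ge> 0"
  obtains w u y where "w 0 = w0" "(w \<longlongrightarrow> w0) (at_right 0)" "(u \<longlongrightarrow> c) (at_right 0)"
    "\<And>r. r > 0 \<Longrightarrow> (w has_real_derivative r powr (- ((N - 1) / (p - 1))) * signed_powr (1 / (p - 1)) (u r)) (at r)"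
    "\<And>r. r > 0 \<Longrightarrow> (u has_real_derivative - \<epsilon> * r powr (N + \<sigma> - 1) * y r powr q) (at r)"
    "(y \<longlongrightarrow> w0) (at_right 0)"
    "\<forall>\<^sub>F r in at_right 0. w r > 0 \<Longrightarrow> local_solution N p q \<sigma> \<epsilon> w"
proof -
  interpret emden_parameters N p q \<sigma> \<epsilon> "w0 + 1" using assms by unfold_locales auto
  obtain r c0 W where W: "(\<lambda>n :: nat. c) \<longlonglongrightarrow> c0" "continuous_on UNIV W" "W = profile_of w0 (flux_of c0 W)"
    by (rule approximations_converge[of "\<lambda>_. c" "\<bar>c\<bar>" w0]) (rule order_refl, blast)
  have "c0 = c" using W(1) LIMSEQ_unique tendsto_const by blast
  then have fixed: "W = profile_of w0 (flux_of c W)" using W(3) by simp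
  note W2 = W(2) fixed
  define w where "w = (\<lambda>r. W (r powr (1 / m)))"
  define u where "u = (\<lambda>r. flux_of c W (r powr (1 / m)))"
  have wlim: "(w \<longlongrightarrow> w0) (at_right 0)" unfolding w_def by (rule radial_tendsto_0[OF W2])
  show ?thesis
  proof (rule that[of w u "\<lambda>r. clamp (w r)"])
    show "w 0 = w0" unfolding w_def using W_0[OF W2] by simp
    show "(w \<longlongrightarrow> w0) (at_right 0)" by (rule wlim)
    show "(u \<longlongrightarrow> c) (at_right 0)" unfolding u_def by (rule radial_tendsto_0[OF W2])
    show "(w has_real_derivative r powr (- ((N - 1) / (p - 1))) * signed_powr (1 / (p - 1)) (u r)) (at r)" if "r > 0" for r
      unfolding w_def u_def by (rule radial_deriv_solution[OF W2 that])
    show "(u has_real_derivative - \<epsilon> * r powr (N + \<sigma> - 1) * clamp (w r) powr q) (at r)" if "r > 0" for r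
      unfolding w_def u_def by (rule radial_deriv_flux[OF W2 that])
    have "((\<lambda>r. clamp (w r)) \<longlongrightarrow> clamp w0) (at_right 0)"
      unfolding clamp_def by (intro tendsto_intros wlim)
    then show "((\<lambda>r. clamp (w r)) \<longlongrightarrow> w0) (at_right 0)" using assms by (simp add: clamp_id)
    show "local_solution N p q \<sigma> \<epsilon> w" if pos: "\<forall>\<^sub>F r in at_right 0. w r > 0"
    proof -
      have "\<forall>\<^sub>F r in at_right 0. w r < w0 + 1" using order_tendstoD(2)[OF wlim] by simp
      with pos have "\<forall>\<^sub>F r in at_right 0. 0 < w r \<and> w r \<le> w0 + 1" by eventually_elim auto
      then obtain r0 where r0: "r0 > 0" "\<And>r. 0 < r \<Longrightarrow> r < r0 \<Longrightarrow> 0 < w r \<and> w r \<le> w0 + 1"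
        unfolding eventually_at_right_field by blast
      have "first_order_solution N p q \<sigma> \<epsilon> {0<..<r0} w u"
        unfolding w_def u_def by (rule radial_first_order_solution[OF W2]) (use r0 in \<open>auto simp: w_def\<close>)
      then have "positive_solution N p q \<sigma> \<epsilon> {0<..<r0} w"
        using assms by (intro first_order_imp_positive_solution) auto
      then show ?thesis unfolding local_solution_def using r0(1) by blast
    qed
  qed
qed

section \<open>The decaying solution for negative sign\<close>

context emden_parameters
begin

context
  assumes eps: "\<epsilon> = -1"
begin

lemma F_eq: "F y = clamp y powr q"
  unfolding F_def by (simp add: eps)

lemma F_nonneg: "F y \<ge> 0"
  by (simp add: F_eq)

lemma F_eq_0: "y \<le> 0 \<Longrightarrow> F y = 0"
  by (simp add: F_eq clamp_nonpos)

lemma flux_of_mono: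
  assumes "continuous_on UNIV w" "0 \<le> s" "s \<le> t"
  shows "flux_of c w s \<le> flux_of c w t"
proof (rule DERIV_nonneg_imp_increasing_open[OF assms(3)])
  fix x assume "s < x" "x < t"
  then have "x > 0" using assms by simp
  moreover have "b x * F (w x) \<ge> 0" by (intro mult_nonneg_nonneg b_nonneg F_nonneg)
  ultimately show "\<exists>y. (flux_of c w has_real_derivative y) (at x) \<and> 0 \<le> y"
    using deriv_flux_of[OF assms(1)] by blast
qed (rule continuous_on_subset[OF cont_flux_of[OF assms(1)]], simp)

lemma flux_of_constant:
  assumes "continuous_on UNIV w" "0 \<le> s" "s \<le> t" "\<And>x. s < x \<Longrightarrow> x < t \<Longrightarrow> w x \<le> 0"
  shows "flux_of c w t = flux_of c w s"
proof (cases "s < t")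
  case True
  show ?thesis
  proof (rule DERIV_isconst_end[OF True])
    show "continuous_on {s..t} (flux_of c w)" by (rule continuous_on_subset[OF cont_flux_of[OF assms(1)]]) simp
    fix x assume x: "s < x" "x < t"
    then have "x > 0" using assms by simp
    then show "(flux_of c w has_real_derivative 0) (at x)"
      using deriv_flux_of[OF assms(1), of x c] F_eq_0[OF assms(4)[OF x]] by simp
  qed
qed (use assms in simp)

lemma profile_of_antimono:
  assumes "continuous_on UNIV v" "0 \<le> s" "s \<le> t" "\<And>x. s < x \<Longrightarrow> x < t \<Longrightarrow> v x \<le> 0"
  shows "profile_of w0 v t \<le> profile_of w0 v s"
proof -
  have "- profile_of w0 v s \<le> - profile_of w0 v t"
  proof (rule DERIV_nonneg_imp_increasing_open[OF assms(3)])
    fix x assume x: "s < x" "x < t"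
    then have x0: "x > 0" using assms by simp
    have "signed_powr (1 / (p - 1)) (v x) \<le> 0" using assms(4)[OF x] by (simp add: signed_powr_def mult_le_0_iff)
    then have "- (a x * signed_powr (1 / (p - 1)) (v x)) \<ge> 0" using a_nonneg[of x] by (simp add: mult_le_0_iff)
    with DERIV_minus[OF deriv_profile_of[OF assms(1) x0]]
    show "\<exists>y. ((\<lambda>x. - profile_of w0 v x) has_real_derivative y) (at x) \<and> 0 \<le> y" by blast
  next
    show "continuous_on {s..t} (\<lambda>x. - profile_of w0 v x)"
      by (intro continuous_intros continuous_on_subset[OF cont_profile_of[OF assms(1)]]) simp
  qed
  then show ?thesis by simp
qed

text \<open>Intermediate values: the flux at \<open>X\<close> depends continuously on the initial flux, is nonnegative when that is \<open>0\<close>, and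
nonpositive when that is very negative.\<close>

lemma shooting:
  obtains c where "c \<le> 0"
    "flux_of c (\<lambda>s. tonelli h c w0 k (s - h)) X = 0"
proof (cases "X \<ge> 0")
  case True
  define \<phi> where "\<phi> c = flux_of c (\<lambda>s. tonelli h c w0 k (s - h)) X" for c
  obtain R where R: "R \<ge> 0" "\<And>c w x. \<bar>c\<bar> \<le> 0 \<Longrightarrow> continuous_on UNIV w \<Longrightarrow> x \<le> X \<Longrightarrow> \<bar>flux_of c w x\<bar> \<le> R"
    using flux_of_local_bound by metis
  have cg: "continuous_on UNIV (\<lambda>s. tonelli h c w0 k (s - h))" for c by (intro cont_shift cont_tonelli)
  have "continuous_on UNIV \<phi>"
    unfolding continuous_on_sequentially \<phi>_def o_def
    by (intro allI ballI impI flux_of_tendsto cg tonelli_continuous_in_flux) auto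
  then have cont: "continuous_on {-R..0} \<phi>" by (rule continuous_on_subset) simp
  have "flux_of (- R) w X = - R + flux_of 0 w X" for w by (simp add: flux_of_def)
  then have "\<phi> (- R) \<le> 0" unfolding \<phi>_def using R(2)[OF _ cg, of 0 X "- R"] by simp
  moreover have "\<phi> 0 \<ge> 0" unfolding \<phi>_def using flux_of_mono[OF cg, of 0 X 0 0] True by simp
  ultimately obtain c where "-R \<le> c" "c \<le> 0" "\<phi> c = 0" using IVT'[of \<phi> "- R" 0 0] R(1) cont by auto
  then show ?thesis using that unfolding \<phi>_def by blast
next
  case False
  then show ?thesis using that[of 0] by simp
qed

text \<open>The initial fluxes stay bounded as the endpoint \<open>n + 1\<close> moves out: a very negative one would bring the profile below
zero before \<open>x = 1/2\<close>; from then on there is no source, the flux is constant, and it could not return to \<open>0\<close>.\<close>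

lemma approximate_decaying_solutions:
  assumes w0: "w0 > 0"
  obtains c C where "\<And>n. \<bar>c n\<bar> \<le> C"
    "\<And>n. flux_of (c n) (\<lambda>s. approx c w0 n (s - 1 / real (Suc n))) (real (Suc n)) = 0"
proof -
  have "\<exists>c\<le>0. flux_of c (\<lambda>s. tonelli (1 / real (Suc n)) c w0 (Suc n * Suc n) (s - 1 / real (Suc n))) (real (Suc n)) = 0" for n
    using shooting by metis
  then obtain c where c: "\<And>n. c n \<le> 0"
    "\<And>n. flux_of (c n) (\<lambda>s. approx c w0 n (s - 1 / real (Suc n))) (real (Suc n)) = 0"
    unfolding approx_def by metis
  obtain R where R: "R \<ge> 0" "\<And>c w x. \<bar>c\<bar> \<le> 0 \<Longrightarrow> continuous_on UNIV w \<Longrightarrow> x \<le> 1 \<Longrightarrow> \<bar>flux_of c w x\<bar> \<le> R"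
    using flux_of_local_bound by metis
  define \<alpha> where "\<alpha> = integral {0..1/2} a"
  have \<alpha>: "\<alpha> > 0"
  proof -
    have "integral {0..0} a < integral {0..1/2} a"
    proof (rule DERIV_pos_imp_increasing_open[where f = "\<lambda>x. integral {0..x} a"])
      fix x :: real assume "0 < x"
      then show "\<exists>y. ((\<lambda>x. integral {0..x} a) has_real_derivative y) (at x) \<and> 0 < y"
        using integral_from_0_deriv[OF cont_a] a_pos by blast
    qed (simp, rule continuous_on_subset[OF integral_from_0_continuous[OF cont_a]], simp)
    then show ?thesis by (simp add: \<alpha>_def)
  qed
  \<comment> \<open>A flux below \<open>- \<kappa>\<close> on \<open>[0, 1/2]\<close> lowers the profile by at least \<open>w0\<close>.\<close>
  define \<kappa> where "\<kappa> = (w0 / \<alpha>) powr (p - 1)"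
  have \<kappa>: "\<kappa> > 0" "\<kappa> powr (1 / (p - 1)) = w0 / \<alpha>" using w0 \<alpha> p1 by (auto simp: \<kappa>_def powr_powr)
  have lower: "c n \<ge> - R - \<kappa>" for n
  proof (rule ccontr)
    assume "\<not> c n \<ge> - R - \<kappa>"
    then have small: "c n < - R - \<kappa>" by simp
    define h where "h = 1 / real (Suc n)"
    define w where "w = approx c w0 n"
    define v where "v = flux_of (c n) (\<lambda>s. w (s - h))"
    have cw: "continuous_on UNIV w" unfolding w_def approx_def by (rule cont_tonelli)
    have cv: "continuous_on UNIV v" unfolding v_def by (intro cont_flux_of cont_shift cw)
    have v_end: "v (real (Suc n)) = 0" using c(2)[of n] by (simp add: v_def w_def h_def)
    have v_neg: "v x \<le> - \<kappa>" if "x \<le> 1" for x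
    proof -
      have "v x = c n + flux_of 0 (\<lambda>s. w (s - h)) x" by (simp add: v_def flux_of_def)
      then show ?thesis using R(2)[OF _ cont_shift[OF cw] that, of 0 h] small by simp
    qed
    have n0: "n \<noteq> 0"
    proof
      assume "n = 0"
      then show False using v_end v_neg[of 1] \<kappa>(1) by simp
    qed
    have v_le: "v x \<le> 0" if "0 \<le> x" "x \<le> real (Suc n)" for x
      using flux_of_mono[OF cont_shift[OF cw] that, of "c n" h] v_end by (simp add: v_def)
    have w_eq: "w x = profile_of w0 v x" if "x \<le> real (Suc n)" for x
      using approx_delayed[OF that, of c w0] unfolding w_def v_def h_def delayed_def by simp
    have "w (1/2) \<le> 0"
    proof -
      have "integral {0..1/2} (\<lambda>s. a s * signed_powr (1 / (p - 1)) (v s)) \<le> integral {0..1/2} (\<lambda>s. a s * (- (w0 / \<alpha>)))"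
      proof (rule integral_le)
        show "(\<lambda>s. a s * signed_powr (1 / (p - 1)) (v s)) integrable_on {0..1/2}"
          by (rule integrable_continuous_real, rule continuous_on_subset[OF cont_apsi[OF cv]]) simp
        show "(\<lambda>s. a s * (- (w0 / \<alpha>))) integrable_on {0..1/2}"
          by (rule integrable_continuous_real) (intro continuous_intros continuous_on_subset[OF cont_a], simp)
        fix s :: real assume "s \<in> {0..1/2}"
        then have "signed_powr (1 / (p - 1)) (v s) \<le> signed_powr (1 / (p - 1)) (- \<kappa>)"
          using p1 by (intro signed_powr_le v_neg) auto
        also have "\<dots> = - (w0 / \<alpha>)" using \<kappa> by (simp add: signed_powr_pos)
        finally show "a s * signed_powr (1 / (p - 1)) (v s) \<le> a s * (- (w0 / \<alpha>))"
          by (intro mult_left_mono a_nonneg)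
      qed
      also have "\<dots> = - w0" using \<alpha> by (simp only: integral_mult_left \<alpha>_def[symmetric]) simp
      finally have "profile_of w0 v (1/2) \<le> 0" by (simp add: profile_of_def)
      then show ?thesis using w_eq[of "1/2"] by simp
    qed
    then have w_nonpos: "w x \<le> 0" if "1/2 \<le> x" "x \<le> real (Suc n)" for x
      using profile_of_antimono[OF cv _ that(1), of w0] v_le that w_eq[of x] w_eq[of "1/2"] by force
    have h: "h \<le> 1/2" "h > 0" unfolding h_def using n0 by (auto simp: field_simps)
    have "v (real (Suc n)) = v 1"
      unfolding v_def
    proof (rule flux_of_constant[OF cont_shift[OF cw]])
      fix x assume "1 < x" "x < real (Suc n)"
      then show "w (x - h) \<le> 0" using h by (intro w_nonpos) auto
    qed auto
    then show False using v_end v_neg[of 1] \<kappa>(1) by simp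
  qed
  have "\<bar>c n\<bar> \<le> R + \<kappa>" for n using lower[of n] c(1)[of n] by simp
  then show ?thesis using c(2) that by blast
qed

text \<open>If the profile and the flux vanished together at \<open>X\<close>, then \<open>- V \<le> K W\<^bsup>q\<^esup>\<close> before \<open>X\<close>, and since
\<open>q / (p - 1) \<ge> 1\<close> the system would give \<open>W' \<ge> - D W\<close>. Then \<open>W exp(D x)\<close> is nondecreasing and cannot reach \<open>0\<close>.\<close>

lemma no_dead_core:
  assumes cW: "continuous_on UNIV W" and fixed: "W = profile_of w0 (flux_of c W)"
    and w0: "0 < w0" "w0 \<le> M"
    and X: "X > 0" "\<And>x. 0 \<le> x \<Longrightarrow> x < X \<Longrightarrow> W x > 0"
    and V: "flux_of c W X = 0"
  shows "W X > 0"
proof -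
  define V where "V = flux_of c W"
  define \<theta> where "\<theta> = 1 / (p - 1)"
  have \<theta>: "\<theta> > 0" "q * \<theta> - 1 > 0" using p1 q by (auto simp: \<theta>_def field_simps)
  have cV: "continuous_on UNIV V" unfolding V_def by (rule cont_flux_of[OF cW])
  have WV: "W = profile_of w0 V" using fixed by (simp add: V_def)
  have V_neg: "V x \<le> 0" if "0 \<le> x" "x \<le> X" for x
    using flux_of_mono[OF cW that, of c] V by (simp add: V_def)
  have W_anti: "W t \<le> W s" if "0 \<le> s" "s \<le> t" "t \<le> X" for s t
    unfolding WV by (rule profile_of_antimono[OF cV that(1,2)]) (use V_neg that in auto)
  have W_le: "W x \<le> w0" if "0 \<le> x" "x \<le> X" for x
    using W_anti[of 0 x] W_0[OF cW fixed] that by simp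
  obtain Ba where Ba: "Ba \<ge> 0" "\<And>s. s \<in> {0..X} \<Longrightarrow> \<bar>a s\<bar> \<le> Ba"
    using continuous_bounded_on_interval[OF cont_a] by metis
  obtain Bb where Bb: "Bb \<ge> 0" "\<And>s. s \<in> {0..X} \<Longrightarrow> \<bar>b s\<bar> \<le> Bb"
    using continuous_bounded_on_interval[OF cont_b] by metis
  define K where "K = X * Bb"
  have K: "K \<ge> 0" using X Bb by (simp add: K_def)
  have V_bound: "- V x \<le> K * W x powr q" if x: "0 < x" "x < X" for x
  proof -
    have "\<exists>l z. z > x \<and> z < X \<and> (V has_real_derivative l) (at z) \<and> V X - V x = (X - x) * l"
    proof (rule MVT[OF x(2)])
      show "continuous_on {x..X} V" by (rule continuous_on_subset[OF cV]) simp
      show "V differentiable (at z)" if "x < z" for z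
        using deriv_flux_of[OF cW, of z c] that x real_differentiable_def unfolding V_def by auto
    qed
    then obtain l z where z: "x < z" "z < X" "(V has_real_derivative l) (at z)" "V X - V x = (X - x) * l"
      by blast
    have "l = b z * F (W z)"
      using DERIV_unique[OF z(3)] deriv_flux_of[OF cW, of z c] z x unfolding V_def by auto
    also have "\<dots> = b z * W z powr q"
      using X(2)[of z] W_le[of z] z x w0 by (simp add: F_eq clamp_id)
    also have "\<dots> \<le> Bb * W x powr q"
      using Bb z x W_anti[of x z] X(2)[of z] q_pos by (intro mult_mono powr_mono2) (auto simp: abs_le_iff)
    finally have l: "l \<le> Bb * W x powr q" .
    have "- V x = (X - x) * l" using z(4) V by (simp add: V_def)
    also have "\<dots> \<le> X * (Bb * W x powr q)"
    proof (rule mult_mono)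
      have "l = b z * F (W z)" by (rule \<open>l = b z * F (W z)\<close>)
      then show "0 \<le> l" using b_nonneg[of z] F_nonneg[of "W z"] by simp
    qed (use l x Bb in auto)
    finally show ?thesis by (simp add: K_def mult.assoc)
  qed
  define D where "D = Ba * (K powr \<theta> * w0 powr (q * \<theta> - 1))"
  have D0: "D \<ge> 0" unfolding D_def using Ba by simp
  have W_deriv: "a x * signed_powr \<theta> (V x) \<ge> - D * W x" if x: "0 < x" "x < X" for x
  proof -
    have Wx: "W x > 0" using X(2) x by simp
    have "- signed_powr \<theta> (V x) = signed_powr \<theta> (- V x)" by simp
    also have "\<dots> \<le> signed_powr \<theta> (K * W x powr q)" using \<theta> by (intro signed_powr_le V_bound x)
    also have "\<dots> = (K * W x powr q) powr \<theta>"
      using K Wx by (cases "K = 0") (auto simp: signed_powr_pos)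
    also have "\<dots> = K powr \<theta> * W x powr (q * \<theta>)" using K Wx by (simp add: powr_mult powr_powr)
    also have "W x powr (q * \<theta>) = W x powr (q * \<theta> - 1) * W x"
      using Wx powr_add[of "W x" "q * \<theta> - 1" 1] by simp
    also have "K powr \<theta> * (W x powr (q * \<theta> - 1) * W x) \<le> K powr \<theta> * (w0 powr (q * \<theta> - 1) * W x)"
      using Wx W_le[of x] x \<theta> by (intro mult_left_mono mult_right_mono powr_mono2) auto
    finally have s: "- signed_powr \<theta> (V x) \<le> K powr \<theta> * w0 powr (q * \<theta> - 1) * W x" by simp
    have "a x * (- signed_powr \<theta> (V x)) \<le> a x * (K powr \<theta> * w0 powr (q * \<theta> - 1) * W x)"
      using s a_nonneg by (rule mult_left_mono)
    also have "\<dots> \<le> Ba * (K powr \<theta> * w0 powr (q * \<theta> - 1) * W x)"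
      using Ba(2)[of x] x Wx by (intro mult_right_mono) (auto simp: abs_le_iff)
    finally show ?thesis unfolding D_def by (simp add: mult.assoc)
  qed
  have "W 0 * exp (D * 0) \<le> W X * exp (D * X)"
  proof (rule DERIV_nonneg_imp_increasing_open[where f = "\<lambda>x. W x * exp (D * x)"])
    fix x assume x: "0 < x" "x < X"
    have "((\<lambda>x. exp (D * x)) has_real_derivative exp (D * x) * D) (at x)"
      by (auto intro!: derivative_eq_intros)
    from DERIV_mult[OF deriv_W[OF cW fixed x(1), folded V_def \<theta>_def] this]
    have "((\<lambda>x. W x * exp (D * x)) has_real_derivative
        a x * signed_powr \<theta> (V x) * exp (D * x) + exp (D * x) * D * W x) (at x)" .
    moreover have "a x * signed_powr \<theta> (V x) * exp (D * x) + exp (D * x) * D * W x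
       = (a x * signed_powr \<theta> (V x) + D * W x) * exp (D * x)" by (simp add: algebra_simps)
    moreover have "\<dots> \<ge> 0" using W_deriv[OF x] by simp
    ultimately show "\<exists>y. ((\<lambda>x. W x * exp (D * x)) has_real_derivative y) (at x) \<and> 0 \<le> y" by metis
  next
    show "continuous_on {0..X} (\<lambda>x. W x * exp (D * x))"
      by (intro continuous_intros continuous_on_subset[OF cW]) simp
  qed (use X in simp)
  then have "W X * exp (D * X) > 0" using W_0[OF cW fixed] w0 by simp
  then show ?thesis by (simp add: zero_less_mult_iff)
qed

text \<open>Limit of the shooting approximations. If the limit profile had a first zero \<open>X\<close> with negative flux, it would become
strictly negative after \<open>X\<close>, and so would the approximations. Their source would then be switched off and their flux,
which vanishes at the far endpoint, would vanish there already, against the negative limit flux. So the flux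
vanishes at \<open>X\<close>, which \<open>no_dead_core\<close> excludes.\<close>

theorem decaying_solution_of_system:
  assumes w0: "0 < w0" "w0 \<le> M"
  obtains W c where "continuous_on UNIV W" "W = profile_of w0 (flux_of c W)" "c < 0"
    "\<And>x. x \<ge> 0 \<Longrightarrow> flux_of c W x \<le> 0" "\<And>x. x \<ge> 0 \<Longrightarrow> 0 < W x" "\<And>x. x \<ge> 0 \<Longrightarrow> W x \<le> w0"
proof -
  obtain cs C where cs: "\<And>n. \<bar>cs n\<bar> \<le> C"
    "\<And>n. flux_of (cs n) (\<lambda>s. approx cs w0 n (s - 1 / real (Suc n))) (real (Suc n)) = 0"
    using approximate_decaying_solutions[OF w0(1)] by metis
  obtain r c W where r: "strict_mono (r :: nat \<Rightarrow> nat)"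
    and "(\<lambda>n. cs (r n)) \<longlonglongrightarrow> c"
    and cW: "continuous_on UNIV W" and fixed: "W = profile_of w0 (flux_of c W)"
    and wlim: "\<And>x. (\<lambda>n. approx cs w0 (r n) x) \<longlonglongrightarrow> W x"
    and vlim: "\<And>x. (\<lambda>n. flux_of (cs (r n)) (\<lambda>s. approx cs w0 (r n) (s - 1 / real (Suc (r n)))) x) \<longlonglongrightarrow> flux_of c W x"
  proof (rule approximations_converge[where c = cs and C = C and ?w0.0 = w0, OF cs(1)])
    fix r c W
    assume "strict_mono (r :: nat \<Rightarrow> nat)" "(\<lambda>n. cs (r n)) \<longlonglongrightarrow> c" "continuous_on UNIV W"
      "W = profile_of w0 (flux_of c W)" "\<And>x. (\<lambda>n. approx cs w0 (r n) x) \<longlonglongrightarrow> W x"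
      "\<And>x. (\<lambda>n. flux_of (cs (r n)) (\<lambda>s. approx cs w0 (r n) (s - 1 / real (Suc (r n)))) x) \<longlonglongrightarrow> flux_of c W x"
    then show thesis by (rule that)
  qed
  define h where "h n = 1 / real (Suc n)" for n
  define w where "w n = approx cs w0 n" for n
  define v where "v n = flux_of (cs n) (\<lambda>s. w n (s - h n))" for n
  define V where "V = flux_of c W"
  have h: "0 < h n" "h n \<le> 1" for n by (auto simp: h_def)
  have cw: "continuous_on UNIV (w n)" for n unfolding w_def approx_def by (rule cont_tonelli)
  have cv: "continuous_on UNIV (v n)" for n unfolding v_def by (intro cont_flux_of cont_shift cw)
  have cV: "continuous_on UNIV V" unfolding V_def by (rule cont_flux_of[OF cW])
  have WV: "W = profile_of w0 V" using fixed by (simp add: V_def)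
  have wlim: "(\<lambda>n. w (r n) x) \<longlonglongrightarrow> W x" for x unfolding w_def by (rule wlim)
  have vlim: "(\<lambda>n. v (r n) x) \<longlonglongrightarrow> V x" for x unfolding v_def w_def h_def V_def by (rule vlim)
  have v_end: "v n (real (Suc n)) = 0" for n using cs(2)[of n] by (simp add: v_def w_def h_def)
  have v_le: "v n x \<le> 0" if "0 \<le> x" "x \<le> real (Suc n)" for n x
    using flux_of_mono[OF cont_shift[OF cw] that, of "cs n" n "h n"] v_end by (simp add: v_def)
  have w_eq: "w n x = profile_of w0 (v n) x" if "x \<le> real (Suc n)" for n x
    using approx_delayed[OF that, of cs w0] unfolding w_def v_def h_def delayed_def by simp
  have w_anti: "w n t \<le> w n s" if "0 \<le> s" "s \<le> t" "t \<le> real (Suc n)" for n s t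
  proof -
    have "profile_of w0 (v n) t \<le> profile_of w0 (v n) s"
      by (rule profile_of_antimono[OF cv that(1,2)], rule v_le) (use that in auto)
    then show ?thesis using w_eq[of t n] w_eq[of s n] that by simp
  qed
  have large: "\<forall>\<^sub>F n in sequentially. x \<le> real (Suc (r n))" for x
  proof -
    obtain K :: nat where K: "x \<le> real K" using real_arch_simple by blast
    have "x \<le> real (Suc (r n))" if "n \<ge> K" for n
    proof -
      have "K \<le> r n" using that seq_suble[OF r, of n] by linarith
      then have "real K \<le> real (Suc (r n))" by simp
      with K show ?thesis by linarith
    qed
    then show ?thesis unfolding eventually_sequentially by blast
  qed
  have V_le: "V x \<le> 0" if "x \<ge> 0" for x
  proof (rule tendsto_upperbound[OF vlim])
    show "\<forall>\<^sub>F n in sequentially. v (r n) x \<le> 0"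
      using large[of x] by eventually_elim (rule v_le[OF that])
  qed simp
  have W_anti: "W t \<le> W s" if "0 \<le> s" "s \<le> t" for s t
    unfolding WV by (rule profile_of_antimono[OF cV that]) (use V_le that in auto)
  have W0: "W 0 = w0" by (rule W_0[OF cW fixed])
  have W_pos: "W x > 0" if x: "x \<ge> 0" for x
  proof (rule ccontr)
    assume neg: "\<not> W x > 0"
    define S where "S = {0..x} \<inter> {y. W y \<le> 0}"
    have "closed {y. W y \<le> 0}" by (rule closed_Collect_le[OF cW continuous_on_const])
    then have cS: "compact S" unfolding S_def by (rule compact_Int_closed[OF compact_Icc])
    have "x \<in> S" using x neg by (simp add: S_def)
    then have "S \<noteq> {}" by blast
    from compact_attains_inf[OF cS this] obtain X where X: "X \<in> S" "\<And>y. y \<in> S \<Longrightarrow> X \<le> y" by blast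
    have X0: "X > 0" using X(1) W0 w0 by (cases "X = 0") (auto simp: S_def)
    have before: "W y > 0" if "0 \<le> y" "y < X" for y
    proof (rule ccontr)
      assume "\<not> W y > 0"
      then have "y \<in> S" using that X(1) by (simp add: S_def)
      then show False using X(2)[of y] that by simp
    qed
    have "W X \<le> 0" using X(1) by (simp add: S_def)
    then have after: "W y \<le> 0" if "X \<le> y" for y using W_anti[of X y] X0 that by linarith
    have V_const: "V y = V X" if "X \<le> y" for y
      unfolding V_def by (rule flux_of_constant[OF cW _ that]) (use X0 after in auto)
    have "V X = 0"
    proof (rule ccontr)
      assume "V X \<noteq> 0"
      then have VX: "V X < 0" using V_le[of X] X0 by simp
      have "W (X + 1) < W X"
      proof (rule DERIV_neg_imp_decreasing_open[where f = W])
        fix y assume y: "X < y" "y < X + 1"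
        then have y0: "y > 0" using X0 by simp
        have "signed_powr (1 / (p - 1)) (V y) < 0" using V_const[of y] y VX by (simp add: signed_powr_neg)
        then have "a y * signed_powr (1 / (p - 1)) (V y) < 0" using a_pos[OF y0] by (simp add: mult_less_0_iff)
        then show "\<exists>l. (W has_real_derivative l) (at y) \<and> l < 0"
          using deriv_W[OF cW fixed y0] unfolding V_def by blast
      qed (simp, rule continuous_on_subset[OF cW], simp)
      then have "W (X + 1) < 0" using after[of X] by simp
      then have "\<forall>\<^sub>F n in sequentially. w (r n) (X + 1) < 0" by (rule order_tendstoD(2)[OF wlim])
      then have "\<forall>\<^sub>F n in sequentially. v (r n) (X + 2) = 0"
        using large[of "X + 2"]
      proof eventually_elim
        case (elim n)
        have "v (r n) (real (Suc (r n))) = v (r n) (X + 2)"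
          unfolding v_def
        proof (rule flux_of_constant[OF cont_shift[OF cw]])
          fix y assume y: "X + 2 < y" "y < real (Suc (r n))"
          have "w (r n) (y - h (r n)) \<le> w (r n) (X + 1)"
            using h[of "r n"] y X0 by (intro w_anti) auto
          then show "w (r n) (y - h (r n)) \<le> 0" using elim(1) by simp
        qed (use X0 elim in auto)
        then show ?case using v_end by simp
      qed
      then have "(\<lambda>n. v (r n) (X + 2)) \<longlonglongrightarrow> 0" by (rule tendsto_eventually)
      then have "V (X + 2) = 0" using vlim LIMSEQ_unique by blast
      then show False using V_const[of "X + 2"] VX by simp
    qed
    then have "W X > 0"
      using no_dead_core[OF cW fixed w0 X0 before] by (simp add: V_def)
    then show False using after[of X] by simp
  qed
  have W_le: "W x \<le> w0" if "x \<ge> 0" for x using W_anti[of 0 x] W0 that by simp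
  have "V 0 < V 1"
  proof (rule DERIV_pos_imp_increasing_open[where f = V])
    fix x :: real assume x: "0 < x" "x < 1"
    have "F (W x) > 0" using W_pos[of x] W_le[of x] x w0 by (simp add: F_eq clamp_id)
    then have "b x * F (W x) > 0" using b_pos[OF x(1)] by simp
    then show "\<exists>l. (V has_real_derivative l) (at x) \<and> 0 < l"
      using deriv_flux_of[OF cW x(1), of c] unfolding V_def by blast
  qed (simp, rule continuous_on_subset[OF cV], simp)
  then have "c < 0" using V_le[of 1] by (simp add: V_def)
  show ?thesis
  proof (rule that[OF cW fixed \<open>c < 0\<close>])
    show "flux_of c W x \<le> 0" if "x \<ge> 0" for x using V_le[OF that] by (simp add: V_def)
  qed (fact W_pos W_le)+
qed

end
end

theorem global_decaying_solution:
  fixes N p q \<sigma> w0 :: real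
  assumes "q > p - 1" "p > 1" "p > N" "N > - \<sigma>" "w0 > 0"
  obtains w u c where "c < 0" "first_order_solution N p q \<sigma> (-1) {0<..} w u"
    "\<And>r. r > 0 \<Longrightarrow> u r \<le> 0" "(w \<longlongrightarrow> w0) (at_right 0)" "(u \<longlongrightarrow> c) (at_right 0)"
proof -
  interpret emden_parameters N p q \<sigma> "-1" w0 using assms by unfold_locales auto
  obtain W c where W: "continuous_on UNIV W" "W = profile_of w0 (flux_of c W)" and c: "c < 0"
    and V: "\<And>x. x \<ge> 0 \<Longrightarrow> flux_of c W x \<le> 0" and b: "\<And>x. x \<ge> 0 \<Longrightarrow> 0 < W x" "\<And>x. x \<ge> 0 \<Longrightarrow> W x \<le> w0"
    using decaying_solution_of_system[OF refl \<open>w0 > 0\<close> order_refl] by metis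
  show ?thesis
  proof (rule that[OF c])
    show "first_order_solution N p q \<sigma> (-1) {0<..} (\<lambda>r. W (r powr (1 / m))) (\<lambda>r. flux_of c W (r powr (1 / m)))"
      by (rule radial_first_order_solution[OF W]) (auto intro: b)
  qed (use V radial_tendsto_0[OF W] in auto)
qed

section \<open>The three local types\<close>

text \<open>Initial flux \<open>0\<close>: l'Hopital's rule gives \<open>u / r\<^bsup>N+\<sigma>\<^esup> \<longlongrightarrow> - \<epsilon> l\<close> with \<open>l = w0\<^bsup>q\<^esup> / (N + \<sigma>)\<close>, and the homogeneity of the
signed power turns this into the rate of \<open>w'\<close>.\<close>

lemma local_solution_vanishing_flux:
  fixes N p q \<sigma> \<epsilon> w0 :: real
  assumes q: "q > p - 1" and p: "p > 1" "p > N" "N > - \<sigma>" and w0: "w0 > 0"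
  shows "\<exists>c>0. \<exists>w. local_solution N p q \<sigma> \<epsilon> w \<and> continuous (at_right 0) w \<and>
     (w \<longlongrightarrow> w0) (at_right 0) \<and>
     ((\<lambda>r. r powr (- ((\<sigma> + 1) / (p - 1))) * deriv w r) \<longlongrightarrow> signed_powr (1 / (p - 1)) (- \<epsilon>) * c) (at_right 0)"
proof -
  define \<theta> where "\<theta> = 1 / (p - 1)"
  have \<theta>: "\<theta> > 0" using p by (simp add: \<theta>_def)
  obtain w u y where w: "w 0 = w0" "(w \<longlongrightarrow> w0) (at_right 0)" "(u \<longlongrightarrow> 0) (at_right 0)"
    "\<And>r. r > 0 \<Longrightarrow> (w has_real_derivative r powr (- ((N - 1) / (p - 1))) * signed_powr \<theta> (u r)) (at r)"
    "\<And>r. r > 0 \<Longrightarrow> (u has_real_derivative - \<epsilon> * r powr (N + \<sigma> - 1) * y r powr q) (at r)"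
    "(y \<longlongrightarrow> w0) (at_right 0)"
    "\<forall>\<^sub>F r in at_right 0. w r > 0 \<Longrightarrow> local_solution N p q \<sigma> \<epsilon> w"
    using cauchy_problem_at_0[OF q p, of w0 0 \<epsilon>] w0 unfolding \<theta>_def by (metis less_imp_le)
  note ev = eventually_at_right_less[of "0 :: real"]
  have Ns: "N + \<sigma> > 0" using p by simp
  define l where "l = w0 powr q / (N + \<sigma>)"
  have l: "l > 0" unfolding l_def using w0 Ns by simp
  have u_lim: "((\<lambda>r. u r / r powr (N + \<sigma>)) \<longlongrightarrow> - \<epsilon> * l) (at_right 0)"
  proof (rule lhopital_right_0[where f' = "\<lambda>r. - \<epsilon> * r powr (N + \<sigma> - 1) * y r powr q"
        and g' = "\<lambda>r. (N + \<sigma>) * r powr (N + \<sigma> - 1)"])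
    show "(u \<longlongrightarrow> 0) (at_right 0)" by (rule w(3))
    have "((\<lambda>r. r powr (N + \<sigma>)) \<longlongrightarrow> 0 powr (N + \<sigma>)) (at_right 0)"
      using Ns ev by (intro tendsto_powr' tendsto_intros) (auto elim: eventually_mono)
    then show "((\<lambda>r. r powr (N + \<sigma>)) \<longlongrightarrow> 0) (at_right 0)" by simp
    show "\<forall>\<^sub>F r in at_right 0. r powr (N + \<sigma>) \<noteq> 0" using ev by eventually_elim auto
    show "\<forall>\<^sub>F r in at_right 0. (N + \<sigma>) * r powr (N + \<sigma> - 1) \<noteq> 0" using ev by eventually_elim (use Ns in auto)
    show "\<forall>\<^sub>F r in at_right 0. (u has_real_derivative - \<epsilon> * r powr (N + \<sigma> - 1) * y r powr q) (at r)"
      using ev by eventually_elim (rule w(5))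
    show "\<forall>\<^sub>F r in at_right 0. ((\<lambda>r. r powr (N + \<sigma>)) has_real_derivative (N + \<sigma>) * r powr (N + \<sigma> - 1)) (at r)"
      using ev by eventually_elim (rule has_real_derivative_powr)
    have "((\<lambda>r. - \<epsilon> * (y r powr q / (N + \<sigma>))) \<longlongrightarrow> - \<epsilon> * l) (at_right 0)"
      unfolding l_def using w0 Ns by (intro tendsto_intros w(6)) auto
    then show "((\<lambda>r. - \<epsilon> * r powr (N + \<sigma> - 1) * y r powr q / ((N + \<sigma>) * r powr (N + \<sigma> - 1))) \<longlongrightarrow> - \<epsilon> * l) (at_right 0)"
      by (rule Lim_transform_eventually) (use ev in eventually_elim, simp)
  qed
  have "isCont (signed_powr \<theta>) (- \<epsilon> * l)"
    using continuous_on_signed_powr[OF \<theta>] by (simp add: continuous_on_eq_continuous_at)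
  from isCont_tendsto_compose[OF this u_lim]
  have "((\<lambda>r. r powr (- ((\<sigma> + 1) / (p - 1))) * deriv w r) \<longlongrightarrow> signed_powr \<theta> (- \<epsilon> * l)) (at_right 0)"
  proof (rule Lim_transform_eventually)
    show "\<forall>\<^sub>F r in at_right 0. signed_powr \<theta> (u r / r powr (N + \<sigma>)) = r powr (- ((\<sigma> + 1) / (p - 1))) * deriv w r"
      using ev
    proof eventually_elim
      case (elim r)
      have "signed_powr \<theta> (u r / r powr (N + \<sigma>)) = signed_powr \<theta> (r powr (- (N + \<sigma>)) * u r)"
        by (simp only: powr_minus divide_inverse mult.commute)
      also have "\<dots> = r powr (- (N + \<sigma>) * \<theta>) * signed_powr \<theta> (u r)"
        using elim by (subst signed_powr_mult) (auto simp: powr_powr)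
      also have "- (N + \<sigma>) * \<theta> = - ((\<sigma> + 1) / (p - 1)) + - ((N - 1) / (p - 1))"
        unfolding \<theta>_def by (simp add: add_divide_distrib diff_divide_distrib)
      also have "r powr \<dots> * signed_powr \<theta> (u r) = r powr (- ((\<sigma> + 1) / (p - 1))) * deriv w r"
        unfolding DERIV_imp_deriv[OF w(4)[OF elim]] powr_add by simp
      finally show ?case .
    qed
  qed
  moreover have "signed_powr \<theta> (- \<epsilon> * l) = signed_powr (1 / (p - 1)) (- \<epsilon>) * l powr \<theta>"
    using signed_powr_mult[OF l, of \<theta> "- \<epsilon>"] unfolding \<theta>_def by (simp only: mult.commute)
  moreover have "local_solution N p q \<sigma> \<epsilon> w"
    using w(7) order_tendstoD(1)[OF w(2), of 0] w0 by blast
  moreover have "continuous (at_right 0) w" unfolding continuous_within using w(1,2) by simp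
  ultimately show ?thesis using w(2) l by (intro exI[of _ "l powr \<theta>"]) auto
qed

text \<open>Initial value \<open>0\<close> and positive initial flux \<open>c\<^bsup>p-1\<^esup>\<close>. Then \<open>w' \<sim> c r\<^bsup>\<delta>-1\<^esup>\<close> with \<open>\<delta> = (p-N)/(p-1)\<close>, hence
\<open>w \<sim> (c/\<delta>) r\<^bsup>\<delta>\<^esup>\<close>, and \<open>c = k \<delta>\<close>. Positivity near \<open>0\<close> is read off from this rate.\<close>

lemma local_solution_from_0:
  fixes N p q \<sigma> \<epsilon> k :: real
  assumes q: "q > p - 1" and p: "p > 1" "p > N" "N > - \<sigma>" and k: "k > 0"
  shows "\<exists>c>0. \<exists>w. local_solution N p q \<sigma> \<epsilon> w \<and> continuous (at_right 0) w \<and>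
     (w \<longlongrightarrow> 0) (at_right 0) \<and>
     ((\<lambda>r. r powr ((N - p) / (p - 1)) * w r) \<longlongrightarrow> k) (at_right 0) \<and>
     ((\<lambda>r. r powr ((N - 1) / (p - 1)) * deriv w r) \<longlongrightarrow> c) (at_right 0)"
proof -
  define \<theta> where "\<theta> = 1 / (p - 1)"
  define \<delta> where "\<delta> = (p - N) / (p - 1)"
  define c where "c = k * \<delta>"
  have \<theta>: "\<theta> > 0" using p by (simp add: \<theta>_def)
  have \<delta>: "\<delta> > 0" using p by (simp add: \<delta>_def)
  have c: "c > 0" using k \<delta> by (simp add: c_def)
  have ex: "\<delta> - 1 = - ((N - 1) / (p - 1))" "(N - p) / (p - 1) = - \<delta>" using p by (simp_all add: \<delta>_def field_simps)
  have "signed_powr \<theta> (c powr (p - 1)) = c" using c p by (simp add: signed_powr_pos \<theta>_def powr_powr)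
  obtain w u where w: "w 0 = 0" "(w \<longlongrightarrow> 0) (at_right 0)" "(u \<longlongrightarrow> c powr (p - 1)) (at_right 0)"
    "\<And>r. r > 0 \<Longrightarrow> (w has_real_derivative r powr (- ((N - 1) / (p - 1))) * signed_powr \<theta> (u r)) (at r)"
    "\<forall>\<^sub>F r in at_right 0. w r > 0 \<Longrightarrow> local_solution N p q \<sigma> \<epsilon> w"
    using cauchy_problem_at_0[OF q p, of 0 "c powr (p - 1)" \<epsilon>] unfolding \<theta>_def by (metis order_refl)
  note ev = eventually_at_right_less[of "0 :: real"]
  have "isCont (signed_powr \<theta>) (c powr (p - 1))"
    using continuous_on_signed_powr[OF \<theta>] by (simp add: continuous_on_eq_continuous_at)
  from isCont_tendsto_compose[OF this w(3)]
  have slope: "((\<lambda>r. signed_powr \<theta> (u r)) \<longlongrightarrow> c) (at_right 0)" by (simp add: \<open>signed_powr \<theta> _ = c\<close>)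
  then have "((\<lambda>r. r powr ((N - 1) / (p - 1)) * deriv w r) \<longlongrightarrow> c) (at_right 0)"
    by (rule Lim_transform_eventually)
       (use ev in eventually_elim, simp add: DERIV_imp_deriv[OF w(4)] powr_minus)
  moreover have ratio: "((\<lambda>r. w r / r powr \<delta>) \<longlongrightarrow> k) (at_right 0)"
  proof (rule lhopital_right_0[where f' = "\<lambda>r. r powr (- ((N - 1) / (p - 1))) * signed_powr \<theta> (u r)"
        and g' = "\<lambda>r. \<delta> * r powr (\<delta> - 1)"])
    show "(w \<longlongrightarrow> 0) (at_right 0)" by (rule w(2))
    have "((\<lambda>r. r powr \<delta>) \<longlongrightarrow> 0 powr \<delta>) (at_right 0)"
      using \<delta> ev by (intro tendsto_powr' tendsto_intros) (auto elim: eventually_mono)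
    then show "((\<lambda>r. r powr \<delta>) \<longlongrightarrow> 0) (at_right 0)" by simp
    show "\<forall>\<^sub>F r in at_right 0. r powr \<delta> \<noteq> 0" using ev by eventually_elim auto
    show "\<forall>\<^sub>F r in at_right 0. \<delta> * r powr (\<delta> - 1) \<noteq> 0" using ev by eventually_elim (use \<delta> in auto)
    show "\<forall>\<^sub>F r in at_right 0. (w has_real_derivative r powr (- ((N - 1) / (p - 1))) * signed_powr \<theta> (u r)) (at r)"
      using ev by eventually_elim (rule w(4))
    show "\<forall>\<^sub>F r in at_right 0. ((\<lambda>r. r powr \<delta>) has_real_derivative \<delta> * r powr (\<delta> - 1)) (at r)"
      using ev by eventually_elim (rule has_real_derivative_powr)
    have "((\<lambda>r. signed_powr \<theta> (u r) / \<delta>) \<longlongrightarrow> c / \<delta>) (at_right 0)" using \<delta> by (intro tendsto_intros slope) auto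
    then have "((\<lambda>r. signed_powr \<theta> (u r) / \<delta>) \<longlongrightarrow> k) (at_right 0)" using \<delta> by (simp add: c_def)
    then show "((\<lambda>r. r powr (- ((N - 1) / (p - 1))) * signed_powr \<theta> (u r) / (\<delta> * r powr (\<delta> - 1))) \<longlongrightarrow> k) (at_right 0)"
      unfolding ex by (rule Lim_transform_eventually) (use ev in eventually_elim, simp)
  qed
  moreover have "((\<lambda>r. r powr ((N - p) / (p - 1)) * w r) \<longlongrightarrow> k) (at_right 0)"
    using ratio unfolding ex(2) by (simp add: powr_minus divide_inverse mult.commute)
  moreover have "local_solution N p q \<sigma> \<epsilon> w"
  proof (rule w(5))
    have "\<forall>\<^sub>F r in at_right 0. w r / r powr \<delta> > 0" using order_tendstoD(1)[OF ratio k] .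
    then show "\<forall>\<^sub>F r in at_right 0. w r > 0" using ev by eventually_elim (auto simp: zero_less_divide_iff)
  qed
  moreover have "continuous (at_right 0) w" unfolding continuous_within using w(1,2) by simp
  ultimately show ?thesis using w(2) c by blast
qed

lemma local_solution_nonzero_flux:
  fixes N p q \<sigma> \<epsilon> w0 :: real
  assumes q: "q > p - 1" and p: "p > 1" "p > N" "N > - \<sigma>" and w0: "w0 > 0"
  shows "\<exists>w. local_solution N p q \<sigma> \<epsilon> w \<and> continuous (at_right 0) w \<and>
     (w \<longlongrightarrow> w0) (at_right 0) \<and>
     ((\<lambda>r. r powr ((N - 1) / (p - 1)) * deriv w r) \<longlongrightarrow> signed_powr (1 / (p - 1)) c) (at_right 0)"
proof -
  define \<theta> where "\<theta> = 1 / (p - 1)"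
  have \<theta>: "\<theta> > 0" using p by (simp add: \<theta>_def)
  obtain w u where w: "w 0 = w0" "(w \<longlongrightarrow> w0) (at_right 0)" "(u \<longlongrightarrow> c) (at_right 0)"
    "\<And>r. r > 0 \<Longrightarrow> (w has_real_derivative r powr (- ((N - 1) / (p - 1))) * signed_powr \<theta> (u r)) (at r)"
    "\<forall>\<^sub>F r in at_right 0. w r > 0 \<Longrightarrow> local_solution N p q \<sigma> \<epsilon> w"
    using cauchy_problem_at_0[OF q p, of w0 c \<epsilon>] w0 unfolding \<theta>_def by (metis less_imp_le)
  note ev = eventually_at_right_less[of "0 :: real"]
  have "isCont (signed_powr \<theta>) c"
    using continuous_on_signed_powr[OF \<theta>] by (simp add: continuous_on_eq_continuous_at)
  from isCont_tendsto_compose[OF this w(3)]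
  have "((\<lambda>r. r powr ((N - 1) / (p - 1)) * deriv w r) \<longlongrightarrow> signed_powr \<theta> c) (at_right 0)"
    by (rule Lim_transform_eventually)
       (use ev in eventually_elim, simp add: DERIV_imp_deriv[OF w(4)] powr_minus)
  moreover have "local_solution N p q \<sigma> \<epsilon> w"
    using w(5) order_tendstoD(1)[OF w(2), of 0] w0 by blast
  moreover have "continuous (at_right 0) w" unfolding continuous_within using w(1,2) by simp
  ultimately show ?thesis using w(2) unfolding \<theta>_def by blast
qed

section \<open>Classification of positive solutions\<close>

theorem theorem4p13:
  fixes N p q \<sigma> :: real
  assumes "q > p - 1" and "p - 1 > 0" and "p > N" and "N > - \<sigma>"
  shows
    "(\<forall>\<epsilon>\<in>{1, -1}.
        (\<forall>w0>0. \<exists>c>0. \<exists>w. local_solution N p q \<sigma> \<epsilon> w \<and> continuous (at_right 0) w \<and>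
           (w \<longlongrightarrow> w0) (at_right 0) \<and>
           ((\<lambda>r. r powr (- ((\<sigma> + 1) / (p - 1))) * deriv w r) \<longlongrightarrow> - \<epsilon> * c) (at_right 0)) \<and>
        (\<forall>k>0. \<exists>c>0. \<exists>w. local_solution N p q \<sigma> \<epsilon> w \<and> continuous (at_right 0) w \<and>
           (w \<longlongrightarrow> 0) (at_right 0) \<and>
           ((\<lambda>r. r powr ((N - p) / (p - 1)) * w r) \<longlongrightarrow> k) (at_right 0) \<and>
           ((\<lambda>r. r powr ((N - 1) / (p - 1)) * deriv w r) \<longlongrightarrow> c) (at_right 0)) \<and>
        (\<forall>w0>0. \<exists>c>0. \<exists>w. local_solution N p q \<sigma> \<epsilon> w \<and> continuous (at_right 0) w \<and>
           (w \<longlongrightarrow> w0) (at_right 0) \<and>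
           ((\<lambda>r. r powr ((N - 1) / (p - 1)) * deriv w r) \<longlongrightarrow> - \<epsilon> * c) (at_right 0))) \<and>
     (\<nexists>w. global_solution N p q \<sigma> 1 w) \<and>
     (\<forall>r0>0. \<nexists>w. positive_solution N p q \<sigma> 1 {r0<..} w) \<and>
     global_solution N p q \<sigma> (-1) (wstar N p q \<sigma>) \<and>
     (\<forall>w0>0. \<exists>c>0. \<exists>w. global_solution N p q \<sigma> (-1) w \<and>
        (w \<longlongrightarrow> w0) (at_right 0) \<and>
        ((\<lambda>r. r powr ((N - 1) / (p - 1)) * deriv w r) \<longlongrightarrow> - c) (at_right 0) \<and>
        w \<sim>[at_top] wstar N p q \<sigma>)"
    (is "?local \<and> ?none \<and> ?none_outside \<and> ?star \<and> ?decaying")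
proof (intro conjI)
  have p: "p > 1" and q: "q > 0" using assms by auto
  note par = assms(1) p assms(3,4)
  show ?local
  proof (rule ballI)
    fix \<epsilon> :: real assume "\<epsilon> \<in> {1, -1}"
    then have \<epsilon>: "signed_powr (1 / (p - 1)) (- \<epsilon>) = - \<epsilon>" by (auto simp: signed_powr_pos)
    show "(\<forall>w0>0. \<exists>c>0. \<exists>w. local_solution N p q \<sigma> \<epsilon> w \<and> continuous (at_right 0) w \<and>
           (w \<longlongrightarrow> w0) (at_right 0) \<and>
           ((\<lambda>r. r powr (- ((\<sigma> + 1) / (p - 1))) * deriv w r) \<longlongrightarrow> - \<epsilon> * c) (at_right 0)) \<and>
        (\<forall>k>0. \<exists>c>0. \<exists>w. local_solution N p q \<sigma> \<epsilon> w \<and> continuous (at_right 0) w \<and>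
           (w \<longlongrightarrow> 0) (at_right 0) \<and>
           ((\<lambda>r. r powr ((N - p) / (p - 1)) * w r) \<longlongrightarrow> k) (at_right 0) \<and>
           ((\<lambda>r. r powr ((N - 1) / (p - 1)) * deriv w r) \<longlongrightarrow> c) (at_right 0)) \<and>
        (\<forall>w0>0. \<exists>c>0. \<exists>w. local_solution N p q \<sigma> \<epsilon> w \<and> continuous (at_right 0) w \<and>
           (w \<longlongrightarrow> w0) (at_right 0) \<and>
           ((\<lambda>r. r powr ((N - 1) / (p - 1)) * deriv w r) \<longlongrightarrow> - \<epsilon> * c) (at_right 0))"
    proof (intro conjI allI impI)
      fix w0 :: real assume w0: "w0 > 0"
      show "\<exists>c>0. \<exists>w. local_solution N p q \<sigma> \<epsilon> w \<and> continuous (at_right 0) w \<and>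
           (w \<longlongrightarrow> w0) (at_right 0) \<and>
           ((\<lambda>r. r powr (- ((\<sigma> + 1) / (p - 1))) * deriv w r) \<longlongrightarrow> - \<epsilon> * c) (at_right 0)"
        using local_solution_vanishing_flux[OF par w0, of \<epsilon>] unfolding \<epsilon> .
      show "\<exists>c>0. \<exists>w. local_solution N p q \<sigma> \<epsilon> w \<and> continuous (at_right 0) w \<and>
           (w \<longlongrightarrow> w0) (at_right 0) \<and>
           ((\<lambda>r. r powr ((N - 1) / (p - 1)) * deriv w r) \<longlongrightarrow> - \<epsilon> * c) (at_right 0)"
        using local_solution_nonzero_flux[OF par w0, of \<epsilon> "- \<epsilon>"] unfolding \<epsilon>
        by (intro exI[of _ 1]) simp
    next
      fix k :: real assume "k > 0"
      then show "\<exists>c>0. \<exists>w. local_solution N p q \<sigma> \<epsilon> w \<and> continuous (at_right 0) w \<and>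
           (w \<longlongrightarrow> 0) (at_right 0) \<and>
           ((\<lambda>r. r powr ((N - p) / (p - 1)) * w r) \<longlongrightarrow> k) (at_right 0) \<and>
           ((\<lambda>r. r powr ((N - 1) / (p - 1)) * deriv w r) \<longlongrightarrow> c) (at_right 0)"
        by (rule local_solution_from_0[OF par])
    qed
  qed
  show ?none
    unfolding global_solution_def using no_positive_solution_near_infinity[of p N \<sigma> q 0] par q by simp
  show ?none_outside
    using no_positive_solution_near_infinity[of p N \<sigma> q] par q by simp
  show ?star
    unfolding global_solution_def
    by (rule first_order_imp_positive_solution[OF p _ _ wstar_first_order[OF par]]) auto
  show ?decaying
  proof (intro allI impI)
    fix w0 :: real assume w0: "w0 > 0"
    obtain w u c where c: "c < 0" and sol: "first_order_solution N p q \<sigma> (-1) {0<..} w u"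
      and u: "\<And>r. r > 0 \<Longrightarrow> u r \<le> 0" and lim: "(w \<longlongrightarrow> w0) (at_right 0)" "(u \<longlongrightarrow> c) (at_right 0)"
      using global_decaying_solution[OF par w0] by metis
    have "isCont (signed_powr (1 / (p - 1))) c"
      using continuous_on_signed_powr[of "1 / (p - 1)"] p by (simp add: continuous_on_eq_continuous_at)
    from isCont_tendsto_compose[OF this lim(2)]
    have "((\<lambda>r. r powr ((N - 1) / (p - 1)) * deriv w r) \<longlongrightarrow> signed_powr (1 / (p - 1)) c) (at_right 0)"
      by (rule Lim_transform_eventually)
         (use eventually_at_right_less[of "0 :: real"] in eventually_elim,
          simp add: first_order_deriv[OF sol] powr_minus)
    then have "((\<lambda>r. r powr ((N - 1) / (p - 1)) * deriv w r) \<longlongrightarrow> - ((- c) powr (1 / (p - 1)))) (at_right 0)"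
      using c by (simp add: signed_powr_neg)
    moreover have "global_solution N p q \<sigma> (-1) w"
      unfolding global_solution_def by (rule first_order_imp_positive_solution[OF p _ _ sol]) auto
    moreover have "w \<sim>[at_top] wstar N p q \<sigma>"
      by (rule decreasing_solution_asymptotic[OF par sol u w0 lim(1)])
    ultimately show "\<exists>c>0. \<exists>w. global_solution N p q \<sigma> (-1) w \<and> (w \<longlongrightarrow> w0) (at_right 0) \<and>
        ((\<lambda>r. r powr ((N - 1) / (p - 1)) * deriv w r) \<longlongrightarrow> - c) (at_right 0) \<and>
        w \<sim>[at_top] wstar N p q \<sigma>"
      using c lim(1) by (intro exI[of _ "(- c) powr (1 / (p - 1))"]) auto
  qed
qed

end
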